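(* Assume that a class of languages $\mathcal{C}$ satisfies the following closure properties: (a) if a nonempty language $L$ with $\epsilon\notin L$ is in the class $\mathcal{C}$, then for every $w\in L$ the language $(L\setminus\{w\})\cup\{\epsilon\}$ is in the class $\mathcal{C}$; (b) if $L_1\subseteq\Sigma_1^*$ and $L_2\subseteq\Sigma_2^*$ are languages in the class $\mathcal{C}$ which contain the empty string, $\epsilon\in L_1$ and $\epsilon\in L_2$, and for which $\Sigma_1\cap\Sigma_2=\varnothing$, then the language $$L=(L_1'L_2')^*\cup(L_1'L_2')^*L_1'\cup(L_2'L_1')^*\cup(L_2'L_1')^*L_2'\cup\{\epsilon\}$$ is in the class $\mathcal{C}$, where $L_1'=L_1\setminus\{\epsilon\}$ and $L_2'=L_2\setminus\{\epsilon\}$. Then the free product of two $\mathcal{C}$-Cayley p.f. linear-time computable groups is $\mathcal{C}$-Cayley p.f. linear-time computable.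
   Context: $\epsilon$ denotes the empty string. Position-faithful one-tape Turing machine: a Turing machine with one semi-infinite tape (infinite in one direction only) whose left-most cell contains a special symbol $\boxplus$ which occurs only there and cannot be modified. On input $x\in\Sigma^*$ the initial tape content is $\boxplus x\boxdot^\infty$, where $\boxdot$ is a special blank symbol and $\Sigma\cap\{\boxplus,\boxdot\}=\varnothing$, and the head starts at $\boxplus$. The machine computes $f:\Sigma^*\to\Sigma^*$ if on every input $x\in\Sigma^*$ it eventually reaches an accepting state and halts with the tape having prefix $\boxplus f(x)\boxdot$ (no restriction on the tape content after this first $\boxdot$). A function $f:\Sigma^*\to\Sigma^*$ is position-faithful (p.f.) linear-time computable if it is computed by a deterministic position-faithful one-tape Turing machine in time linear in the input length. Let $G$ be a finitely generated group, $S=\{s_1,\dots,s_n\}\subset G$ a finite set of semigroup generators (every $g\in G$ is a product of elements of $S$), and $\mathcal{C}$ a nonempty class of languages. $G$ is $\mathcal{C}$-Cayley p.f. linear-time computable if there exist a language $L\subseteq\Sigma^*$ in the class $\mathcal{C}$ over a finite alphabet $\Sigma$, a bijection $\psi:L\to G$ and p.f. linear-time computable functions $f_i:\Sigma^*\to\Sigma^*$, $i=1,\dots,n$, with $f_i(L)\subseteq L$ and $\psi(f_i(w))=\psi(w)s_i$ for all $w\in L$. This notion does not depend on the choice of $S$. Standing assumption: $\mathcal{C}$ is closed under a change of symbols in the alphabet: if $\xi:\Sigma\to\Sigma'$ is a bijection between finite alphabets and $L\subseteq\Sigma^*$ is in $\mathcal{C}$, then the image of $L$ under the homomorphism induced by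 $\xi$ is in $\mathcal{C}$. *)

theory Defs
  imports "HOL-Algebra.Group"
begin

section \<open>Position-faithful one-tape Turing machines\<close>

datatype 'a tape_symbol = LeftEnd | Blank | Sym 'a

datatype move = MoveLeft | Stay | MoveRight

text \<open>The set \<open>tm_symbols\<close> holds the tape symbols other than the left-end marker and the
  blank.  The transition function is partial: the machine halts where it is undefined.\<close>

record ('q, 'a) pf_tm =
  tm_states :: "'q set"
  tm_symbols :: "'a set"
  tm_start :: 'q
  tm_accept :: "'q set"
  tm_delta :: "'q \<Rightarrow> 'a tape_symbol \<Rightarrow> ('q \<times> 'a tape_symbol \<times> move) option"

definition tape_alphabet :: "('q, 'a) pf_tm \<Rightarrow> 'a tape_symbol set" where
  "tape_alphabet M = {LeftEnd, Blank} \<union> Sym ` tm_symbols M"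

definition wf_pf_tm :: "'a set \<Rightarrow> ('q, 'a) pf_tm \<Rightarrow> bool" where
  "wf_pf_tm \<Sigma> M \<longleftrightarrow>
     finite (tm_states M) \<and> finite (tm_symbols M) \<and> \<Sigma> \<subseteq> tm_symbols M \<and>
     tm_start M \<in> tm_states M \<and> tm_accept M \<subseteq> tm_states M \<and>
     (\<forall>q \<in> tm_states M. \<forall>a \<in> tape_alphabet M. \<forall>q' b m.
        tm_delta M q a = Some (q', b, m) \<longrightarrow>
          q' \<in> tm_states M \<and> b \<in> tape_alphabet M \<and>
          (b = LeftEnd \<longleftrightarrow> a = LeftEnd) \<and> (a = LeftEnd \<longrightarrow> m \<noteq> MoveLeft))"

text \<open>A configuration consists of the state, the tape content and the head position;
  cell \<open>0\<close> is the left-most one.\<close>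

type_synonym ('q, 'a) config = "'q \<times> (nat \<Rightarrow> 'a tape_symbol) \<times> nat"

fun move_head :: "move \<Rightarrow> nat \<Rightarrow> nat" where
  "move_head MoveLeft p = p - 1"
| "move_head Stay p = p"
| "move_head MoveRight p = p + 1"

text \<open>Halted configurations are fixed points of \<open>tm_step\<close>.\<close>

fun tm_step :: "('q, 'a) pf_tm \<Rightarrow> ('q, 'a) config \<Rightarrow> ('q, 'a) config" where
  "tm_step M (q, t, p) =
     (case tm_delta M q (t p) of
        None \<Rightarrow> (q, t, p)
      | Some (q', b, m) \<Rightarrow> (q', t(p := b), move_head m p))"

definition initial_tape :: "'a list \<Rightarrow> nat \<Rightarrow> 'a tape_symbol" where
  "initial_tape x i =
     (if i = 0 then LeftEnd else if i \<le> length x then Sym (x ! (i - 1)) else Blank)"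

definition initial_config :: "('q, 'a) pf_tm \<Rightarrow> 'a list \<Rightarrow> ('q, 'a) config" where
  "initial_config M x = (tm_start M, initial_tape x, 0)"

fun accepting_halt :: "('q, 'a) pf_tm \<Rightarrow> ('q, 'a) config \<Rightarrow> bool" where
  "accepting_halt M (q, t, p) \<longleftrightarrow> q \<in> tm_accept M \<and> tm_delta M q (t p) = None"

text \<open>The tape has the prefix consisting of the left-end marker, \<open>y\<close> and a blank;
  what follows is unrestricted.\<close>

fun has_output :: "('q, 'a) config \<Rightarrow> 'a list \<Rightarrow> bool" where
  "has_output (q, t, p) y \<longleftrightarrow>
     t 0 = LeftEnd \<and> (\<forall>i < length y. t (i + 1) = Sym (y ! i)) \<and> t (length y + 1) = Blank"

definition computes_within ::
  "('q, 'a) pf_tm \<Rightarrow> 'a set \<Rightarrow> ('a list \<Rightarrow> 'a list) \<Rightarrow> (nat \<Rightarrow> nat) \<Rightarrow> bool" where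
  "computes_within M \<Sigma> f T \<longleftrightarrow>
     (\<forall>x \<in> lists \<Sigma>. \<exists>k \<le> T (length x).
        let c = (tm_step M ^^ k) (initial_config M x)
        in accepting_halt M c \<and> has_output c (f x))"

text \<open>Symbols and states range over the natural numbers, which contain a copy of every finite
  alphabet and every finite set of states.\<close>

definition pf_linear_time_computable :: "nat set \<Rightarrow> (nat list \<Rightarrow> nat list) \<Rightarrow> bool" where
  "pf_linear_time_computable \<Sigma> f \<longleftrightarrow>
     f ` lists \<Sigma> \<subseteq> lists \<Sigma> \<and>
     (\<exists>(M :: (nat, nat) pf_tm) a b.
        wf_pf_tm \<Sigma> M \<and> computes_within M \<Sigma> f (\<lambda>n. a * n + b))"

section \<open>Languages and classes of languages\<close>

definition conc :: "'a list set \<Rightarrow> 'a list set \<Rightarrow> 'a list set" (infixr "\<cdot>" 75) where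
  "A \<cdot> B = {u @ v | u v. u \<in> A \<and> v \<in> B}"

definition star :: "'a list set \<Rightarrow> 'a list set" where
  "star A = concat ` lists A"

text \<open>A nonempty collection of languages, each over some finite alphabet, that is closed under
  a change of symbols.\<close>

definition language_class :: "nat list set set \<Rightarrow> bool" where
  "language_class \<C> \<longleftrightarrow>
     \<C> \<noteq> {} \<and>
     (\<forall>L \<in> \<C>. \<exists>\<Sigma>. finite \<Sigma> \<and> L \<subseteq> lists \<Sigma>) \<and>
     (\<forall>\<Sigma> \<Sigma>' \<xi> L. finite \<Sigma> \<and> finite \<Sigma>' \<and> bij_betw \<xi> \<Sigma> \<Sigma>' \<and> L \<subseteq> lists \<Sigma> \<and> L \<in> \<C> \<longrightarrow>
        map \<xi> ` L \<in> \<C>)"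

section \<open>Cayley position-faithful linear-time computable groups\<close>

definition semigroup_generators :: "('a, 'm) monoid_scheme \<Rightarrow> 'a set \<Rightarrow> bool" where
  "semigroup_generators G S \<longleftrightarrow>
     S \<subseteq> carrier G \<and>
     (\<forall>g \<in> carrier G. \<exists>xs. xs \<noteq> [] \<and> set xs \<subseteq> S \<and> g = foldr (\<otimes>\<^bsub>G\<^esub>) xs \<one>\<^bsub>G\<^esub>)"

definition cayley_pf_linear_time_computable ::
  "nat list set set \<Rightarrow> ('a, 'm) monoid_scheme \<Rightarrow> bool" where
  "cayley_pf_linear_time_computable \<C> G \<longleftrightarrow>
     group G \<and>
     (\<exists>S \<Sigma> L \<psi>.
        finite S \<and> semigroup_generators G S \<and>
        finite \<Sigma> \<and> L \<subseteq> lists \<Sigma> \<and> L \<in> \<C> \<and> bij_betw \<psi> L (carrier G) \<and>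
        (\<forall>s \<in> S. \<exists>f. pf_linear_time_computable \<Sigma> f \<and> f ` L \<subseteq> L \<and>
                     (\<forall>w \<in> L. \<psi> (f w) = \<psi> w \<otimes>\<^bsub>G\<^esub> s)))"

section \<open>The free product of two groups\<close>

text \<open>Elements are the reduced words: alternating sequences of nontrivial elements of the two
  factors.  Two reduced words are multiplied by concatenation followed by reduction, which is
  carried out by prepending the letters of the first word to the second one by one.\<close>

fun fp_cons ::
  "('a, 'm) monoid_scheme \<Rightarrow> ('b, 'n) monoid_scheme \<Rightarrow> 'a + 'b \<Rightarrow> ('a + 'b) list \<Rightarrow> ('a + 'b) list"
where
  "fp_cons G H (Inl a) (Inl b # w) =
     (if a \<otimes>\<^bsub>G\<^esub> b = \<one>\<^bsub>G\<^esub> then w else Inl (a \<otimes>\<^bsub>G\<^esub> b) # w)"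
| "fp_cons G H (Inr a) (Inr b # w) =
     (if a \<otimes>\<^bsub>H\<^esub> b = \<one>\<^bsub>H\<^esub> then w else Inr (a \<otimes>\<^bsub>H\<^esub> b) # w)"
| "fp_cons G H x w = x # w"

definition free_product ::
  "('a, 'm) monoid_scheme \<Rightarrow> ('b, 'n) monoid_scheme \<Rightarrow> ('a + 'b) list monoid" where
  "free_product G H =
     \<lparr>carrier = {w. set w \<subseteq> Inl ` (carrier G - {\<one>\<^bsub>G\<^esub>}) \<union> Inr ` (carrier H - {\<one>\<^bsub>H\<^esub>}) \<and>
                    successively (\<lambda>x y. isl x \<noteq> isl y) w},
      mult = (\<lambda>u v. foldr (fp_cons G H) u v),
      one = []\<rparr>"

end

theory Submission
  imports Defs "HOL-Library.Sublist"
begin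

text \<open>
  Represent the neutral element of each factor by the empty word and make the two alphabets disjoint.
  A reduced word of the free product is then encoded by concatenating the representatives of its
  letters.  The blocks can be read off because the alphabet changes exactly at their boundaries, so the
  encoding is injective, and its image is the language of alternating concatenations that the class is
  assumed to contain (\<open>inj_on_encode\<close>, \<open>encode_image\<close>).

  Right multiplication by a generator \<open>s\<close> of one factor acts on the encoding by applying the function
  of that factor to the longest suffix over its alphabet.  This suffix is empty when the
  reduced word is empty or ends with a letter of the other factor, and then represents the neutral
  element; conversely the suffix becomes empty when the last letter cancels (\<open>encode_mult_syllable_Inl\<close>).
  A Turing machine can apply a function to such a suffix in place and in linear time: it finds
  the last symbol of the other alphabet and lets the original machine treat that symbol as the left-end
  marker (\<open>pf_linear_time_computable_on_suffix\<close>).  Working in place matters, since carrying a word over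
  an unbounded distance can take quadratic time on one tape.

  Making the empty word the representative of the neutral element is a translation if the empty word is
  in the language already; otherwise one word is exchanged for the empty one.  The exchange alters the
  multiplication functions at two arguments only, and changing finitely many values preserves
  linear-time computability (\<open>pf_linear_time_computable_fun_upd\<close>, \<open>cayley_normal_form\<close>).

  The group axioms of the free product reduce to the fact that each factor acts on the reduced words by
  prepending a letter (\<open>fp_cons_Inl_Inl\<close>, \<open>foldr_fp_cons_fp_cons\<close>).
\<close>

section \<open>Runs, invariants and renaming of machines\<close>

text \<open>The bound is an upper bound on the number of steps because the running time of a machine is only
  bounded by the linear function, not equal to it; bounds add up under composition of phases.\<close>

definition reaches :: "('q, 'a) pf_tm \<Rightarrow> ('q, 'a) config \<Rightarrow> nat \<Rightarrow> ('q, 'a) config \<Rightarrow> bool" where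
  "reaches M c n c' \<longleftrightarrow> (\<exists>k \<le> n. (tm_step M ^^ k) c = c')"

lemma reaches_refl: "reaches M c n c"
  unfolding reaches_def by (rule exI[of _ 0]) simp

lemma reaches_trans:
  assumes "reaches M c m c'" "reaches M c' n c''"
  shows "reaches M c (m + n) c''"
proof -
  obtain k l where "k \<le> m" "(tm_step M ^^ k) c = c'" "l \<le> n" "(tm_step M ^^ l) c' = c''"
    using assms unfolding reaches_def by blast
  then have "l + k \<le> m + n" "(tm_step M ^^ (l + k)) c = c''"
    by (simp_all add: funpow_add)
  then show ?thesis unfolding reaches_def by blast
qed

lemma reaches_step:
  assumes "reaches M (tm_step M c) n c'"
  shows "reaches M c (Suc n) c'"
proof -
  have "(tm_step M ^^ 1) c = tm_step M c" by simp
  then have "reaches M c 1 (tm_step M c)" unfolding reaches_def by blast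
  from reaches_trans[OF this assms] show ?thesis by simp
qed

lemma reaches_mono:
  assumes "reaches M c m c'" "m \<le> n"
  shows "reaches M c n c'"
  using reaches_trans[OF assms(1) reaches_refl, of "n - m"] assms(2) by simp

lemma computes_within_iff_reaches:
  "computes_within M \<Sigma> f T \<longleftrightarrow>
     (\<forall>x \<in> lists \<Sigma>. \<exists>c. reaches M (initial_config M x) (T (length x)) c \<and>
        accepting_halt M c \<and> has_output c (f x))"
  unfolding computes_within_def reaches_def Let_def by blast

text \<open>Halted configurations are fixed points of the step function, so a relation that is preserved by
  simultaneous steps carries a whole run over, with the same bound on its length.\<close>

lemma reaches_simulation:
  assumes sim: "\<And>c d. R c d \<Longrightarrow> R (tm_step M c) (tm_step N d)"
    and "R c d" and "reaches M c n c'"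
  shows "\<exists>d'. reaches N d n d' \<and> R c' d'"
proof -
  obtain k where k: "k \<le> n" "(tm_step M ^^ k) c = c'"
    using assms(3) unfolding reaches_def by blast
  have "R ((tm_step M ^^ k) c) ((tm_step N ^^ k) d)"
    by (induction k) (use assms(2) sim in auto)
  then show ?thesis using k unfolding reaches_def by blast
qed

text \<open>The invariants of the runs of a well-formed machine.  A simulation needs them because the transition
  function is unconstrained on states and symbols outside the machine, and because the left-end
  marker has to be recognisable by its position.\<close>

fun valid_config :: "('q, 'a) pf_tm \<Rightarrow> ('q, 'a) config \<Rightarrow> bool" where
  "valid_config M (q, t, p) \<longleftrightarrow>
     q \<in> tm_states M \<and> (\<forall>i. t i \<in> tape_alphabet M) \<and> (\<forall>i. t i = LeftEnd \<longleftrightarrow> i = 0)"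

lemma wf_pf_tm_basicD:
  assumes "wf_pf_tm \<Sigma> M"
  shows "finite (tm_states M)" "finite (tm_symbols M)" "\<Sigma> \<subseteq> tm_symbols M"
    "tm_start M \<in> tm_states M" "tm_accept M \<subseteq> tm_states M"
  using assms unfolding wf_pf_tm_def by blast+

lemma wf_pf_tmI:
  assumes "finite (tm_states M)" "finite (tm_symbols M)" "\<Sigma> \<subseteq> tm_symbols M"
    "tm_start M \<in> tm_states M" "tm_accept M \<subseteq> tm_states M"
    and "\<And>q a q' b m. q \<in> tm_states M \<Longrightarrow> a \<in> tape_alphabet M \<Longrightarrow>
      tm_delta M q a = Some (q', b, m) \<Longrightarrow>
      q' \<in> tm_states M \<and> b \<in> tape_alphabet M \<and>
      (b = LeftEnd \<longleftrightarrow> a = LeftEnd) \<and> (a = LeftEnd \<longrightarrow> m \<noteq> MoveLeft)"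
  shows "wf_pf_tm \<Sigma> M"
  using assms unfolding wf_pf_tm_def by blast

lemma wf_pf_tm_deltaD:
  assumes "wf_pf_tm \<Sigma> M" "q \<in> tm_states M" "a \<in> tape_alphabet M" "tm_delta M q a = Some (q', b, m)"
  shows "q' \<in> tm_states M" "b \<in> tape_alphabet M" "b = LeftEnd \<longleftrightarrow> a = LeftEnd"
    "a = LeftEnd \<Longrightarrow> m \<noteq> MoveLeft"
  using assms unfolding wf_pf_tm_def by blast+

lemma valid_config_step:
  assumes "wf_pf_tm \<Sigma> M" "valid_config M c"
  shows "valid_config M (tm_step M c)"
proof (cases c)
  case (fields q t p)
  then show ?thesis
    using assms wf_pf_tm_deltaD[OF assms(1), of q "t p"] by (auto split: option.split)
qed

lemma valid_initial_config:
  assumes "wf_pf_tm \<Sigma> M" "x \<in> lists \<Sigma>"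
  shows "valid_config M (initial_config M x)"
proof -
  have "x ! (i - Suc 0) \<in> tm_symbols M" if "0 < i" "i \<le> length x" for i
    using assms(2) wf_pf_tm_basicD(3)[OF assms(1)] nth_mem[of "i - Suc 0" x] that by auto
  then show ?thesis
    using wf_pf_tm_basicD(4)[OF assms(1)]
    by (auto simp: initial_config_def initial_tape_def tape_alphabet_def)
qed

text \<open>States and symbols are renamed by functions that need to be injective only on the machine, so that
  an arbitrary finite set of states can be sent into the natural numbers.\<close>

definition rename_tm :: "('q \<Rightarrow> 'r) \<Rightarrow> ('a \<Rightarrow> 'b) \<Rightarrow> ('q, 'a) pf_tm \<Rightarrow> ('r, 'b) pf_tm" where
  "rename_tm \<sigma> \<xi> M =
     \<lparr>tm_states = \<sigma> ` tm_states M, tm_symbols = \<xi> ` tm_symbols M,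
      tm_start = \<sigma> (tm_start M), tm_accept = \<sigma> ` tm_accept M,
      tm_delta = (\<lambda>q a. map_option (\<lambda>(q', b, m). (\<sigma> q', map_tape_symbol \<xi> b, m))
        (tm_delta M (inv_into (tm_states M) \<sigma> q)
                    (inv_into (tape_alphabet M) (map_tape_symbol \<xi>) a)))\<rparr>"

lemma tape_alphabet_rename_tm:
  "tape_alphabet (rename_tm \<sigma> \<xi> M) = map_tape_symbol \<xi> ` tape_alphabet M"
  by (force simp: tape_alphabet_def rename_tm_def)

lemma inj_on_map_tape_symbol:
  assumes "inj_on \<xi> (tm_symbols M)"
  shows "inj_on (map_tape_symbol \<xi>) (tape_alphabet M)"
  using assms by (auto simp: inj_on_def tape_alphabet_def)

lemma delta_rename_tm:
  assumes "inj_on \<sigma> (tm_states M)" "inj_on \<xi> (tm_symbols M)"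
    and "q \<in> tm_states M" "a \<in> tape_alphabet M"
  shows "tm_delta (rename_tm \<sigma> \<xi> M) (\<sigma> q) (map_tape_symbol \<xi> a) =
     map_option (\<lambda>(q', b, m). (\<sigma> q', map_tape_symbol \<xi> b, m)) (tm_delta M q a)"
  using assms inj_on_map_tape_symbol[OF assms(2)] by (simp add: rename_tm_def)

lemma map_tape_symbol_eq_LeftEnd: "map_tape_symbol \<xi> a = LeftEnd \<longleftrightarrow> a = LeftEnd"
  by (cases a) auto

lemma wf_rename_tm:
  assumes wf: "wf_pf_tm \<Sigma> M" and inj: "inj_on \<sigma> (tm_states M)" "inj_on \<xi> (tm_symbols M)"
  shows "wf_pf_tm (\<xi> ` \<Sigma>) (rename_tm \<sigma> \<xi> M)"
proof -
  have delta: "q' \<in> \<sigma> ` tm_states M \<and> b \<in> map_tape_symbol \<xi> ` tape_alphabet M \<and>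
      (b = LeftEnd \<longleftrightarrow> a = LeftEnd) \<and> (a = LeftEnd \<longrightarrow> m \<noteq> MoveLeft)"
    if q: "q \<in> \<sigma> ` tm_states M" and a: "a \<in> map_tape_symbol \<xi> ` tape_alphabet M"
      and d: "tm_delta (rename_tm \<sigma> \<xi> M) q a = Some (q', b, m)" for q a q' b m
  proof -
    obtain r c where rc: "r \<in> tm_states M" "q = \<sigma> r" "c \<in> tape_alphabet M" "a = map_tape_symbol \<xi> c"
      using q a by blast
    obtain r' e where re: "tm_delta M r c = Some (r', e, m)" "q' = \<sigma> r'" "b = map_tape_symbol \<xi> e"
      using d rc delta_rename_tm[OF inj] by auto
    note wf_pf_tm_deltaD[OF wf rc(1,3) re(1)]
    then show ?thesis
      unfolding rc re map_tape_symbol_eq_LeftEnd by blast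
  qed
  have states: "tm_states (rename_tm \<sigma> \<xi> M) = \<sigma> ` tm_states M"
    by (simp add: rename_tm_def)
  show ?thesis
    by (rule wf_pf_tmI, unfold states tape_alphabet_rename_tm, rule_tac [6] delta)
      (use wf_pf_tm_basicD[OF wf] in \<open>auto simp: rename_tm_def\<close>)
qed

lemma lists_imageE:
  assumes "v \<in> lists (f ` A)"
  obtains x where "x \<in> lists A" "v = map f x"
proof -
  have "v \<in> map f ` lists A" using assms by (simp only: lists_image)
  then show ?thesis using that by (elim imageE)
qed

lemma computes_within_rename_tm:
  assumes wf: "wf_pf_tm \<Sigma> M" and inj: "inj_on \<sigma> (tm_states M)" "inj_on \<xi> (tm_symbols M)"
    and comp: "computes_within M \<Sigma> f T"
    and g: "\<And>x. x \<in> lists \<Sigma> \<Longrightarrow> g (map \<xi> x) = map \<xi> (f x)"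
  shows "computes_within (rename_tm \<sigma> \<xi> M) (\<xi> ` \<Sigma>) g T"
  unfolding computes_within_iff_reaches
proof
  fix y assume "y \<in> lists (\<xi> ` \<Sigma>)"
  then obtain x where x: "x \<in> lists \<Sigma>" "y = map \<xi> x"
    by (rule lists_imageE)
  define R where "R c d \<longleftrightarrow> valid_config M c \<and>
      d = (case c of (q, t, p) \<Rightarrow> (\<sigma> q, map_tape_symbol \<xi> \<circ> t, p))" for c d
  obtain c where c: "reaches M (initial_config M x) (T (length x)) c" "accepting_halt M c"
      "has_output c (f x)"
    using comp x(1) unfolding computes_within_iff_reaches by blast
  have step: "R (tm_step M c) (tm_step (rename_tm \<sigma> \<xi> M) d)" if "R c d" for c d
  proof (cases c)
    case (fields q t p)
    then have "tm_delta (rename_tm \<sigma> \<xi> M) (\<sigma> q) (map_tape_symbol \<xi> (t p)) =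
        map_option (\<lambda>(q', b, m). (\<sigma> q', map_tape_symbol \<xi> b, m)) (tm_delta M q (t p))"
      using that by (intro delta_rename_tm[OF inj]) (auto simp: R_def)
    then show ?thesis
      using that fields valid_config_step[OF wf, of c]
      by (auto simp: R_def fun_upd_def comp_def split: option.split)
  qed
  have init: "R (initial_config M x) (initial_config (rename_tm \<sigma> \<xi> M) y)"
  proof -
    have "initial_tape y = map_tape_symbol \<xi> \<circ> initial_tape x"
      using x by (auto simp: initial_tape_def fun_eq_iff)
    then show ?thesis
      using valid_initial_config[OF wf x(1)]
      by (simp add: R_def initial_config_def rename_tm_def)
  qed
  obtain d where d: "reaches (rename_tm \<sigma> \<xi> M) (initial_config (rename_tm \<sigma> \<xi> M) y) (T (length x)) d"
      "R c d"
    using reaches_simulation[of R, OF step init c(1)] by blast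
  obtain q t p where qtp: "c = (q, t, p)" by (cases c)
  have d_eq: "d = (\<sigma> q, map_tape_symbol \<xi> \<circ> t, p)" and valid: "valid_config M c"
    using d(2) qtp by (auto simp: R_def)
  have "accepting_halt (rename_tm \<sigma> \<xi> M) d"
    using c(2) valid qtp d_eq delta_rename_tm[OF inj, of q "t p"] by (auto simp: rename_tm_def)
  moreover have "has_output d (g y)"
    using c(3) qtp d_eq x g by auto
  ultimately show "\<exists>d. reaches (rename_tm \<sigma> \<xi> M) (initial_config (rename_tm \<sigma> \<xi> M) y) (T (length y)) d \<and>
      accepting_halt (rename_tm \<sigma> \<xi> M) d \<and> has_output d (g y)"
    using d(1) x(2) by (intro exI[of _ d]) simp
qed

text \<open>The machines below have structured states; only the finiteness of the set of states
  matters, since it embeds into the natural numbers.\<close>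

lemma pf_linear_time_computableI:
  fixes M :: "('q, nat) pf_tm"
  assumes wf: "wf_pf_tm \<Sigma> M" and comp: "computes_within M \<Sigma> f (\<lambda>n. a * n + b)"
    and f: "\<And>x. x \<in> lists \<Sigma> \<Longrightarrow> f x \<in> lists \<Sigma>"
  shows "pf_linear_time_computable \<Sigma> f"
proof -
  obtain \<sigma> :: "'q \<Rightarrow> nat" where "inj_on \<sigma> (tm_states M)"
    using finite_imp_inj_to_nat_seg[OF wf_pf_tm_basicD(1)[OF wf]] by metis
  then have "wf_pf_tm (id ` \<Sigma>) (rename_tm \<sigma> id M)"
      "computes_within (rename_tm \<sigma> id M) (id ` \<Sigma>) f (\<lambda>n. a * n + b)"
    by (intro wf_rename_tm[OF wf] computes_within_rename_tm[OF wf _ _ comp]; simp)+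
  then show ?thesis using f unfolding pf_linear_time_computable_def by auto
qed

section \<open>Changing one value of a linear-time computable function\<close>

text \<open>The machine for \<^term>\<open>f(x := y)\<close> compares its input with \<open>x\<close> without changing the tape,
  rewinds, and then writes \<open>y\<close> or starts the machine for \<open>f\<close> on the untouched input.
  \<open>Compare zs\<close> holds the part of \<open>x\<close> still to be seen, \<open>Rewind b\<close> remembers the outcome and
  \<open>Write zs\<close> holds the part of \<open>y\<close> still to be written.\<close>

datatype 'q update_state =
  Compare "nat list" | Rewind bool | Write "nat list" | Done | Run 'q

fun update_delta ::
  "('q, nat) pf_tm \<Rightarrow> nat list \<Rightarrow> 'q update_state \<Rightarrow> nat tape_symbol \<Rightarrow>
     ('q update_state \<times> nat tape_symbol \<times> move) option"
where
  "update_delta M y (Compare zs) LeftEnd = Some (Compare zs, LeftEnd, MoveRight)"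
| "update_delta M y (Compare zs) Blank = Some (Rewind (zs = []), Blank, MoveLeft)"
| "update_delta M y (Compare []) (Sym c) = Some (Rewind False, Sym c, MoveLeft)"
| "update_delta M y (Compare (z # zs)) (Sym c) =
     (if c = z then Some (Compare zs, Sym c, MoveRight) else Some (Rewind False, Sym c, MoveLeft))"
| "update_delta M y (Rewind b) (Sym c) = Some (Rewind b, Sym c, MoveLeft)"
| "update_delta M y (Rewind b) LeftEnd =
     (if b then Some (Write y, LeftEnd, MoveRight) else Some (Run (tm_start M), LeftEnd, Stay))"
| "update_delta M y (Rewind b) Blank = None"
| "update_delta M y (Write zs) LeftEnd = None"
| "update_delta M y (Write []) _ = Some (Done, Blank, Stay)"
| "update_delta M y (Write (z # zs)) _ = Some (Write zs, Sym z, MoveRight)"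
| "update_delta M y Done _ = None"
| "update_delta M y (Run q) a = map_option (\<lambda>(q', b, m). (Run q', b, m)) (tm_delta M q a)"

definition update_tm :: "('q, nat) pf_tm \<Rightarrow> nat list \<Rightarrow> nat list \<Rightarrow> ('q update_state, nat) pf_tm" where
  "update_tm M x y =
     \<lparr>tm_states = Compare ` set (suffixes x) \<union> range Rewind \<union> Write ` set (suffixes y) \<union> {Done} \<union>
        Run ` tm_states M,
      tm_symbols = tm_symbols M,
      tm_start = Compare x, tm_accept = {Done} \<union> Run ` tm_accept M,
      tm_delta = update_delta M y\<rparr>"

lemma update_tm_simps [simp]:
  "tm_start (update_tm M x y) = Compare x"
  "tm_delta (update_tm M x y) = update_delta M y"
  "tm_accept (update_tm M x y) = {Done} \<union> Run ` tm_accept M"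
  by (simp_all add: update_tm_def)

lemma wf_update_tm:
  assumes wf: "wf_pf_tm \<Sigma> M" and y: "y \<in> lists \<Sigma>"
  shows "wf_pf_tm \<Sigma> (update_tm M x y)"
proof -
  have alpha: "tape_alphabet (update_tm M x y) = tape_alphabet M"
    by (simp add: tape_alphabet_def update_tm_def)
  have y': "set y \<subseteq> tm_symbols M"
    using wf_pf_tm_basicD(3)[OF wf] y by auto
  have delta: "q' \<in> tm_states (update_tm M x y) \<and> b \<in> tape_alphabet M \<and>
      (b = LeftEnd \<longleftrightarrow> a = LeftEnd) \<and> (a = LeftEnd \<longrightarrow> m \<noteq> MoveLeft)"
    if q: "q \<in> tm_states (update_tm M x y)" and a: "a \<in> tape_alphabet M"
      and d: "update_delta M y q a = Some (q', b, m)" for q a q' b m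
  proof (cases q)
    case (Run r)
    then have "r \<in> tm_states M" using q by (auto simp: update_tm_def)
    then show ?thesis
      using Run d a wf_pf_tm_deltaD[OF wf, of r a] by (auto simp: update_tm_def)
  next
    case (Compare zs)
    have "suffix zs x" using q Compare by (auto simp: update_tm_def)
    then show ?thesis
      using Compare a d
      by (cases zs; cases a) (auto simp: update_tm_def tape_alphabet_def split: if_splits dest: suffix_ConsD)
  next
    case (Rewind b)
    show ?thesis
      using Rewind a d wf_pf_tm_basicD(4)[OF wf]
      by (cases a) (auto simp: update_tm_def tape_alphabet_def split: if_splits)
  next
    case (Write zs)
    have "suffix zs y" using q Write by (auto simp: update_tm_def)
    moreover from this have "set zs \<subseteq> tm_symbols M" using y' set_mono_suffix by blast
    ultimately show ?thesis
      using Write a d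
      by (cases zs; cases a) (auto simp: update_tm_def tape_alphabet_def dest: suffix_ConsD)
  next
    case Done
    then show ?thesis using d by simp
  qed
  show ?thesis
    by (rule wf_pf_tmI, unfold alpha update_tm_simps, rule_tac [6] delta)
      (use wf_pf_tm_basicD[OF wf] in \<open>auto simp: update_tm_def\<close>)
qed

lemma initial_tape_0 [simp]: "initial_tape x 0 = LeftEnd"
  by (simp add: initial_tape_def)

lemma initial_tape_eq_LeftEnd: "\<forall>i. initial_tape x i = LeftEnd \<longleftrightarrow> i = 0"
  by (auto simp: initial_tape_def)

lemma initial_tape_append_Cons [simp]: "initial_tape (u @ c # v) (Suc (length u)) = Sym c"
  by (simp add: initial_tape_def)

lemma initial_tape_end [simp]: "initial_tape u (Suc (length u)) = Blank"
  by (simp add: initial_tape_def)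

text \<open>A failing comparison stops at the first mismatch, which leaves the head somewhere on the input.\<close>

lemma update_tm_compare:
  "\<exists>p \<le> length (u @ v). reaches (update_tm M x y)
     (Compare zs, initial_tape (u @ v), Suc (length u)) (Suc (length zs))
     (Rewind (v = zs), initial_tape (u @ v), p)"
proof (induction zs arbitrary: u v)
  case Nil
  have "reaches (update_tm M x y) (Compare [], initial_tape (u @ v), Suc (length u)) (Suc 0)
     (Rewind (v = []), initial_tape (u @ v), length u)"
    by (rule reaches_step, cases v) (simp_all add: fun_upd_idem reaches_refl)
  then show ?case by (intro exI[of _ "length u"]) simp
next
  case (Cons z zs)
  show ?case
  proof (cases "\<exists>w. v = z # w")
    case True
    then obtain w where w: "v = z # w" by blast
    obtain p where "p \<le> length (u @ v)" "reaches (update_tm M x y)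
        (Compare zs, initial_tape (u @ v), Suc (Suc (length u))) (Suc (length zs))
        (Rewind (w = zs), initial_tape (u @ v), p)"
      using Cons.IH[of "u @ [z]" w] w by auto
    then show ?thesis
      using w by (intro exI[of _ p] conjI, simp, rule_tac reaches_step) (simp add: fun_upd_idem)
  next
    case False
    then have "reaches (update_tm M x y)
        (Compare (z # zs), initial_tape (u @ v), Suc (length u)) (Suc (Suc (length zs)))
        (Rewind (v = z # zs), initial_tape (u @ v), length u)"
      by (rule_tac reaches_step, cases v) (auto simp: fun_upd_idem intro: reaches_refl)
    then show ?thesis by (intro exI[of _ "length u"]) simp
  qed
qed

lemma update_tm_rewind:
  "p \<le> length w \<Longrightarrow>
     reaches (update_tm M x y) (Rewind b, initial_tape w, p) p (Rewind b, initial_tape w, 0)"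
proof (induction p)
  case 0
  show ?case by (rule reaches_refl)
next
  case (Suc p)
  then have "initial_tape w (Suc p) = Sym (w ! p)"
    by (simp add: initial_tape_def)
  then show ?case
    using Suc by (intro reaches_step) (simp add: fun_upd_idem)
qed

lemma update_tm_write:
  assumes "\<forall>i. t i = LeftEnd \<longleftrightarrow> i = 0" and "p > 0"
  shows "\<exists>t'. reaches (update_tm M x y) (Write zs, t, p) (Suc (length zs)) (Done, t', p + length zs) \<and>
     (\<forall>i < p. t' i = t i) \<and> (\<forall>i < length zs. t' (p + i) = Sym (zs ! i)) \<and> t' (p + length zs) = Blank"
  using assms
proof (induction zs arbitrary: t p)
  case Nil
  have "update_delta M y (Write []) (t p) = Some (Done, Blank, Stay)"
    using Nil by (cases "t p") auto
  then have "reaches (update_tm M x y) (Write [], t, p) (Suc (length []))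
      (Done, t(p := Blank), p + length [])"
    by (intro reaches_step) (simp add: reaches_refl)
  then show ?case by (rule_tac exI, rule_tac conjI, assumption) simp
next
  case (Cons z zs)
  let ?t = "t(p := Sym z)"
  have LeftEnd: "\<forall>i. ?t i = LeftEnd \<longleftrightarrow> i = 0" using Cons.prems by simp
  obtain t' where t': "reaches (update_tm M x y) (Write zs, ?t, Suc p) (Suc (length zs))
       (Done, t', Suc p + length zs)"
      "\<forall>i < Suc p. t' i = ?t i" "\<forall>i < length zs. t' (Suc p + i) = Sym (zs ! i)"
      "t' (Suc p + length zs) = Blank"
    using Cons.IH[OF LeftEnd, of "Suc p"] by blast
  have "update_delta M y (Write (z # zs)) (t p) = Some (Write zs, Sym z, MoveRight)"
    using Cons.prems by (cases "t p") auto
  then have "reaches (update_tm M x y) (Write (z # zs), t, p) (Suc (length (z # zs)))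
       (Done, t', p + length (z # zs))"
    using t'(1) by (intro reaches_step) auto
  moreover have "t' (p + i) = Sym ((z # zs) ! i)" if "i < length (z # zs)" for i
    using that t'(2,3) by (cases i) auto
  ultimately show ?case using t' by (intro exI[of _ t']) auto
qed

lemma update_tm_decide:
  "reaches (update_tm M x y) (initial_config (update_tm M x y) w) (length x + length w + 2)
     (Rewind (w = x), initial_tape w, 0)"
proof -
  obtain p where p: "p \<le> length w" "reaches (update_tm M x y)
      (Compare x, initial_tape w, Suc 0) (Suc (length x)) (Rewind (w = x), initial_tape w, p)"
    using update_tm_compare[of "[]" w M x y x] by auto
  have "reaches (update_tm M x y) (initial_config (update_tm M x y) w) (Suc (Suc (length x) + p))
      (Rewind (w = x), initial_tape w, 0)"
    using reaches_trans[OF p(2) update_tm_rewind[OF p(1)]]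
    by (intro reaches_step) (simp add: initial_config_def fun_upd_idem)
  then show ?thesis by (rule reaches_mono) (use p(1) in simp)
qed

text \<open>This replaces composition with a transposition of two words: composing would require erasing
  the garbage that a machine may leave behind its output, whereas an exceptional input is
  recognised before the original machine has touched the tape.\<close>

theorem pf_linear_time_computable_fun_upd:
  assumes "pf_linear_time_computable \<Sigma> f" and y: "y \<in> lists \<Sigma>"
  shows "pf_linear_time_computable \<Sigma> (f(x := y))"
proof -
  obtain M :: "(nat, nat) pf_tm" and a b where M: "wf_pf_tm \<Sigma> M"
      "computes_within M \<Sigma> f (\<lambda>n. a * n + b)" and f: "f ` lists \<Sigma> \<subseteq> lists \<Sigma>"
    using assms unfolding pf_linear_time_computable_def by blast
  let ?N = "update_tm M x y" and ?b = "b + length x + length y + 5"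
  have "\<exists>d. reaches ?N (initial_config ?N w) ((a + 1) * length w + ?b) d \<and>
      accepting_halt ?N d \<and> has_output d ((f(x := y)) w)" if w: "w \<in> lists \<Sigma>" for w
  proof (cases "w = x")
    case True
    obtain t where t: "reaches ?N (Write y, initial_tape w, Suc 0) (Suc (length y))
        (Done, t, Suc 0 + length y)"
        "\<forall>i < Suc 0. t i = initial_tape w i" "\<forall>i < length y. t (Suc 0 + i) = Sym (y ! i)"
        "t (Suc 0 + length y) = Blank"
      using update_tm_write[of "initial_tape w" "Suc 0" M x y y] initial_tape_eq_LeftEnd by blast
    have "reaches ?N (Rewind (w = x), initial_tape w, 0) (Suc (Suc (length y))) (Done, t, Suc 0 + length y)"
        using t(1) True by (rule_tac reaches_step) (simp add: fun_upd_idem)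
    then have "reaches ?N (initial_config ?N w) ((a + 1) * length w + ?b) (Done, t, Suc 0 + length y)"
      by (rule reaches_mono[OF reaches_trans[OF update_tm_decide]]) simp
    then show ?thesis using t True by (intro exI conjI) auto
  next
    case False
    define R where "R c d \<longleftrightarrow> d = (case c of (q, t, p) \<Rightarrow> (Run q, t, p))"
      for c :: "(nat, nat) config" and d
    obtain c where c: "reaches M (initial_config M w) (a * length w + b) c" "accepting_halt M c"
        "has_output c (f w)"
      using M(2) w unfolding computes_within_iff_reaches by blast
    have step: "R (tm_step M c) (tm_step ?N d)" if "R c d" for c d
      using that by (cases c) (auto simp: R_def split: option.split)
    have init: "R (initial_config M w) (Run (tm_start M), initial_tape w, 0)"
      by (simp add: R_def initial_config_def)
    obtain d where d: "reaches ?N (Run (tm_start M), initial_tape w, 0) (a * length w + b) d" "R c d"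
      using reaches_simulation[of R, OF step init c(1)] by blast
    have "reaches ?N (Rewind (w = x), initial_tape w, 0) (Suc (a * length w + b)) d"
      using d(1) False by (intro reaches_step) (simp add: fun_upd_idem)
    then have "reaches ?N (initial_config ?N w) ((a + 1) * length w + ?b) d"
      by (rule reaches_mono[OF reaches_trans[OF update_tm_decide]]) simp
    moreover have "accepting_halt ?N d" "has_output d (f w)"
      using c d(2) by (cases c; auto simp: R_def)+
    ultimately show ?thesis using False by (intro exI[of _ d]) simp
  qed
  then have "computes_within ?N \<Sigma> (f(x := y)) (\<lambda>n. (a + 1) * n + ?b)"
    unfolding computes_within_iff_reaches by blast
  then show ?thesis
    by (rule pf_linear_time_computableI[OF wf_update_tm[OF M(1) y]]) (use f y in auto)
qed

section \<open>Applying a linear-time computable function to a suffix\<close>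

text \<open>On an input \<open>u @ v\<close>, where \<open>v\<close> is the longest suffix without symbols of \<open>\<Delta>\<close>, the machine runs
  the given machine on \<open>v\<close> in place.  To that machine, which never moves left of the left-end
  marker, the last symbol of \<open>u\<close> looks like the marker.  The cells beyond \<open>v\<close> are blank, so they
  give it the tape that it expects, and its output appears right behind \<open>u\<close>.\<close>

datatype 'q suffix_state = ToEnd | ToSuffix | Sim 'q

fun suffix_delta ::
  "('q, 'a) pf_tm \<Rightarrow> 'a set \<Rightarrow> 'q suffix_state \<Rightarrow> 'a tape_symbol \<Rightarrow>
     ('q suffix_state \<times> 'a tape_symbol \<times> move) option"
where
  "suffix_delta M \<Delta> ToEnd Blank = Some (ToSuffix, Blank, MoveLeft)"
| "suffix_delta M \<Delta> ToEnd a = Some (ToEnd, a, MoveRight)"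
| "suffix_delta M \<Delta> ToSuffix Blank = None"
| "suffix_delta M \<Delta> ToSuffix LeftEnd = Some (Sim (tm_start M), LeftEnd, Stay)"
| "suffix_delta M \<Delta> ToSuffix (Sym c) =
     (if c \<in> \<Delta> then Some (Sim (tm_start M), Sym c, Stay) else Some (ToSuffix, Sym c, MoveLeft))"
| "suffix_delta M \<Delta> (Sim q) a =
     (if a \<in> Sym ` \<Delta> then map_option (\<lambda>(q', b, m). (Sim q', a, m)) (tm_delta M q LeftEnd)
      else map_option (\<lambda>(q', b, m). (Sim q', b, m)) (tm_delta M q a))"

definition suffix_tm :: "('q, 'a) pf_tm \<Rightarrow> 'a set \<Rightarrow> ('q suffix_state, 'a) pf_tm" where
  "suffix_tm M \<Delta> =
     \<lparr>tm_states = {ToEnd, ToSuffix} \<union> Sim ` tm_states M, tm_symbols = tm_symbols M \<union> \<Delta>,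
      tm_start = ToEnd, tm_accept = Sim ` tm_accept M, tm_delta = suffix_delta M \<Delta>\<rparr>"

lemma suffix_tm_simps [simp]:
  "tm_start (suffix_tm M \<Delta>) = ToEnd"
  "tm_delta (suffix_tm M \<Delta>) = suffix_delta M \<Delta>"
  "tm_accept (suffix_tm M \<Delta>) = Sim ` tm_accept M"
  by (simp_all add: suffix_tm_def)

lemma wf_suffix_tm:
  assumes wf: "wf_pf_tm \<Sigma> M" and \<Delta>: "finite \<Delta>"
  shows "wf_pf_tm (\<Sigma> \<union> \<Delta>) (suffix_tm M \<Delta>)"
proof -
  have alpha: "tape_alphabet (suffix_tm M \<Delta>) = tape_alphabet M \<union> Sym ` \<Delta>"
    by (auto simp add: tape_alphabet_def suffix_tm_def)
  have delta: "q' \<in> tm_states (suffix_tm M \<Delta>) \<and> b \<in> tape_alphabet M \<union> Sym ` \<Delta> \<and>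
      (b = LeftEnd \<longleftrightarrow> a = LeftEnd) \<and> (a = LeftEnd \<longrightarrow> m \<noteq> MoveLeft)"
    if q: "q \<in> tm_states (suffix_tm M \<Delta>)" and a: "a \<in> tape_alphabet M \<union> Sym ` \<Delta>"
      and d: "suffix_delta M \<Delta> q a = Some (q', b, m)" for q a q' b m
  proof (cases q)
    case (Sim r)
    then have r: "r \<in> tm_states M" using q by (auto simp: suffix_tm_def)
    have "LeftEnd \<in> tape_alphabet M" by (simp add: tape_alphabet_def)
    show ?thesis
    proof (cases "a \<in> Sym ` \<Delta>")
      case True
      then obtain r' b' where r': "tm_delta M r LeftEnd = Some (r', b', m)" "q' = Sim r'" "b = a"
        using d Sim by auto
      note wf_pf_tm_deltaD(1)[OF wf r \<open>LeftEnd \<in> _\<close> r'(1)]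
      then show ?thesis using True r' by (auto simp: suffix_tm_def)
    next
      case False
      then obtain r' where r': "tm_delta M r a = Some (r', b, m)" "q' = Sim r'"
        using d Sim by auto
      have "a \<in> tape_alphabet M" using a False by blast
      note wf_pf_tm_deltaD[OF wf r this r'(1)]
      then show ?thesis using r' by (auto simp: suffix_tm_def)
    qed
  qed (use a d wf_pf_tm_basicD(4)[OF wf] in
      \<open>cases a; auto simp: suffix_tm_def tape_alphabet_def split: if_splits\<close>)+
  show ?thesis
    by (rule wf_pf_tmI, unfold alpha suffix_tm_simps, rule_tac [6] delta)
      (use wf_pf_tm_basicD[OF wf] \<Delta> in \<open>auto simp: suffix_tm_def\<close>)
qed

lemma suffix_tm_to_end:
  "reaches (suffix_tm M \<Delta>) (ToEnd, initial_tape (u @ v), length u) (length v + 2)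
     (ToSuffix, initial_tape (u @ v), length (u @ v))"
proof (induction v arbitrary: u)
  case Nil
  have "suffix_delta M \<Delta> ToEnd (initial_tape u (length u)) =
      Some (ToEnd, initial_tape u (length u), MoveRight)"
    by (auto simp: initial_tape_def)
  then have "reaches (suffix_tm M \<Delta>) (ToEnd, initial_tape u, length u) (Suc (Suc 0))
      (ToSuffix, initial_tape u, length u)"
    by (intro reaches_step) (simp add: fun_upd_idem reaches_refl)
  then show ?case by simp
next
  case (Cons c v)
  have "suffix_delta M \<Delta> ToEnd (initial_tape (u @ c # v) (length u)) =
      Some (ToEnd, initial_tape (u @ c # v) (length u), MoveRight)"
    by (auto simp: initial_tape_def)
  then show ?case
    using Cons.IH[of "u @ [c]"] by (simp, rule_tac reaches_step) (simp add: fun_upd_idem)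
qed

lemma suffix_tm_to_suffix:
  assumes u: "u = [] \<or> last u \<in> \<Delta>" and "set v \<inter> \<Delta> = {}"
  shows "reaches (suffix_tm M \<Delta>) (ToSuffix, initial_tape (u @ v @ w), length (u @ v)) (Suc (length v))
     (Sim (tm_start M), initial_tape (u @ v @ w), length u)"
  using assms(2)
proof (induction v arbitrary: w rule: rev_induct)
  case Nil
  have "initial_tape (u @ w) (length u) = (if u = [] then LeftEnd else Sym (last u))"
    by (auto simp: initial_tape_def nth_append last_conv_nth)
  then have "suffix_delta M \<Delta> ToSuffix (initial_tape (u @ w) (length u)) =
      Some (Sim (tm_start M), initial_tape (u @ w) (length u), Stay)"
    using u by auto
  then show ?case by (simp, rule_tac reaches_step) (auto intro: reaches_refl)
next
  case (snoc c v)
  have "initial_tape ((u @ v) @ c # w) (Suc (length (u @ v))) = Sym c"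
    by (rule initial_tape_append_Cons)
  then show ?case
    using snoc.IH[of "c # w"] snoc.prems by (simp, rule_tac reaches_step) (simp add: fun_upd_idem)
qed

text \<open>The tape of the simulated machine is the tape of \<^term>\<open>suffix_tm M \<Delta>\<close> shifted by the length of \<open>u\<close>,
  except that cell \<open>0\<close>, the left-end marker, corresponds to the last cell of \<open>u\<close>.  The time bound
  has one pass to the end of the input, one pass back over \<open>v\<close>, and the simulated run.\<close>

lemma suffix_tm_computes:
  assumes wf: "wf_pf_tm \<Sigma> M" and disj: "\<Delta> \<inter> tm_symbols M = {}"
    and u: "u = [] \<or> last u \<in> \<Delta>" and v: "v \<in> lists \<Sigma>"
    and c: "reaches M (initial_config M v) n c" "accepting_halt M c" "has_output c y"
  shows "\<exists>d. reaches (suffix_tm M \<Delta>) (initial_config (suffix_tm M \<Delta>) (u @ v))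
       (length (u @ v) + length v + 3 + n) d \<and>
     accepting_halt (suffix_tm M \<Delta>) d \<and> has_output d (u @ y)"
proof -
  let ?N = "suffix_tm M \<Delta>"
  define R where "R c d \<longleftrightarrow> (case c of (q, t, p) \<Rightarrow> case d of (q', t', p') \<Rightarrow>
      valid_config M c \<and> q' = Sim q \<and> p' = length u + p \<and>
      (\<forall>i > 0. t' (length u + i) = t i) \<and> (\<forall>i \<le> length u. t' i = initial_tape u i))" for c d
  have step: "R (tm_step M c) (tm_step ?N d)" if R: "R c d" for c d
  proof -
    obtain q t p where c: "c = (q, t, p)" by (cases c)
    obtain t' where d: "d = (Sim q, t', length u + p)" and valid: "valid_config M c"
        and t': "\<forall>i > 0. t' (length u + i) = t i" "\<forall>i \<le> length u. t' i = initial_tape u i"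
      using R by (cases d) (auto simp: R_def c)
    have valid': "valid_config M (tm_step M c)"
      using valid_config_step[OF wf valid] .
    \<comment> \<open>Only for \<open>p = 0\<close> can the two machines see different symbols; the shifted one writes back its own.\<close>
    have delta: "suffix_delta M \<Delta> (Sim q) (t' (length u + p)) =
        map_option (\<lambda>(q', b, m). (Sim q', if p = 0 then t' (length u) else b, m)) (tm_delta M q (t p))"
    proof (cases "p = 0")
      case True
      have "t p = LeftEnd" using valid c True by simp
      moreover have "t' (length u) = (if u = [] then LeftEnd else Sym (last u))"
        using t' by (auto simp: initial_tape_def last_conv_nth)
      moreover have "b = LeftEnd" if "tm_delta M q LeftEnd = Some (q', b, m)" for q' b m
        using wf_pf_tm_deltaD(3)[OF wf _ _ that] valid c \<open>t p = LeftEnd\<close>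
        by (auto simp: tape_alphabet_def)
      ultimately show ?thesis
        using u True by (cases "tm_delta M q LeftEnd") auto
    next
      case False
      have "t' (length u + p) = t p" using False t' by simp
      moreover have "t p \<notin> Sym ` \<Delta>"
      proof -
        have "t p \<in> tape_alphabet M" using valid c by simp
        then show ?thesis using disj by (auto simp: tape_alphabet_def)
      qed
      ultimately show ?thesis using False by simp
    qed
    show ?thesis
    proof (cases "tm_delta M q (t p)")
      case None
      then show ?thesis using R delta by (simp add: c d)
    next
      case (Some r)
      obtain q' b m where r: "r = (q', b, m)" by (cases r)
      have m: "m \<noteq> MoveLeft" if "p = 0"
        using wf_pf_tm_deltaD(4)[OF wf _ _ Some[unfolded r]] valid that unfolding c
        by (metis valid_config.simps)
      have "move_head m (length u + p) = length u + move_head m p"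
        using m by (cases m; cases p) auto
      then show ?thesis
        using valid' Some delta t' by (auto simp: R_def c d r)
    qed
  qed
  let ?d = "(Sim (tm_start M), initial_tape (u @ v), length u)"
  have init: "R (initial_config M v) ?d"
    using valid_initial_config[OF wf v]
    by (auto simp: R_def initial_config_def initial_tape_def nth_append)
  obtain d where d: "reaches ?N ?d n d" "R c d"
    using reaches_simulation[of R, OF step init c(1)] by blast
  have v': "set v \<inter> \<Delta> = {}"
    using v wf_pf_tm_basicD(3)[OF wf] disj by auto
  have "reaches ?N (initial_config ?N (u @ v)) (length (u @ v) + 2)
      (ToSuffix, initial_tape (u @ v), length (u @ v))"
    using suffix_tm_to_end[of M \<Delta> "[]" "u @ v"] by (simp add: initial_config_def)
  moreover have "reaches ?N (ToSuffix, initial_tape (u @ v), length (u @ v)) (Suc (length v)) ?d"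
    using suffix_tm_to_suffix[OF u v', of M "[]"] by simp
  ultimately have "reaches ?N (initial_config ?N (u @ v)) (length (u @ v) + 2 + Suc (length v) + n) d"
    using reaches_trans d(1) by blast
  moreover obtain q t p q' t' p' where cd: "c = (q, t, p)" "d = (q', t', p')"
    by (cases c; cases d)
  then have R: "q' = Sim q" "p' = length u + p" "\<forall>i > 0. t' (length u + i) = t i"
      "\<forall>i \<le> length u. t' i = initial_tape u i" "valid_config M (q, t, p)"
    using d(2) by (auto simp: R_def)
  have "accepting_halt ?N d"
  proof -
    have halt: "tm_delta M q (t p) = None" "q \<in> tm_accept M" using c(2) cd by auto
    have "suffix_delta M \<Delta> (Sim q) (t' (length u + p)) = None"
    proof (cases "p = 0")
      case True
      then have "t p = LeftEnd" using R by simp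
      moreover have "t' (length u) = (if u = [] then LeftEnd else Sym (last u))"
        using R by (auto simp: initial_tape_def last_conv_nth)
      ultimately show ?thesis using True halt u by auto
    next
      case False
      then have "t' (length u + p) = t p" using R by simp
      moreover have "t p \<in> tape_alphabet M" using R by simp
      ultimately show ?thesis using disj halt by (auto simp: tape_alphabet_def)
    qed
    then show ?thesis using halt cd R by simp
  qed
  moreover have "has_output d (u @ y)"
  proof -
    have "t' (Suc i) = Sym ((u @ y) ! i)" if "i < length (u @ y)" for i
    proof (cases "i < length u")
      case True
      then show ?thesis using R by (simp add: initial_tape_def nth_append)
    next
      case False
      have "t' (length u + Suc (i - length u)) = t (Suc (i - length u))"
        using R(3) by blast
      then show ?thesis using False that c(3) cd by (simp add: nth_append)
    qed
    moreover have "t' 0 = LeftEnd" using R by simp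
    moreover have "t' (Suc (length u + length y)) = Blank"
      using R(3)[rule_format, of "Suc (length y)"] c(3) cd by simp
    ultimately show ?thesis using cd by simp
  qed
  ultimately show ?thesis by (intro exI[of _ d]) (auto elim: reaches_mono)
qed

definition on_suffix :: "'a set \<Rightarrow> ('a list \<Rightarrow> 'a list) \<Rightarrow> 'a list \<Rightarrow> 'a list" where
  "on_suffix \<Sigma> f w =
     rev (dropWhile (\<lambda>c. c \<in> \<Sigma>) (rev w)) @ f (rev (takeWhile (\<lambda>c. c \<in> \<Sigma>) (rev w)))"

lemma on_suffix_append:
  assumes "u = [] \<or> last u \<notin> \<Sigma>" "v \<in> lists \<Sigma>"
  shows "on_suffix \<Sigma> f (u @ v) = u @ f v"
proof -
  have "dropWhile (\<lambda>c. c \<in> \<Sigma>) (rev u) = rev u" "takeWhile (\<lambda>c. c \<in> \<Sigma>) (rev u) = []"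
    using assms(1) by (cases u rule: rev_cases; simp)+
  moreover have "\<forall>c \<in> set (rev v). c \<in> \<Sigma>" using assms(2) by auto
  ultimately show ?thesis
    unfolding on_suffix_def rev_append
    by (subst dropWhile_append2, simp, subst takeWhile_append2, simp_all)
qed

lemma split_at_suffix:
  obtains u v where "w = u @ v" "u = [] \<or> last u \<notin> \<Sigma>" "v \<in> lists \<Sigma>"
proof
  show "w = rev (dropWhile (\<lambda>c. c \<in> \<Sigma>) (rev w)) @ rev (takeWhile (\<lambda>c. c \<in> \<Sigma>) (rev w))"
    by (metis rev_append rev_rev_ident takeWhile_dropWhile_id)
  show "rev (dropWhile (\<lambda>c. c \<in> \<Sigma>) (rev w)) = [] \<or> last (rev (dropWhile (\<lambda>c. c \<in> \<Sigma>) (rev w))) \<notin> \<Sigma>"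
    using hd_dropWhile[of "\<lambda>c. c \<in> \<Sigma>" "rev w"] by (auto simp: last_rev)
  show "rev (takeWhile (\<lambda>c. c \<in> \<Sigma>) (rev w)) \<in> lists \<Sigma>"
    by (auto dest: set_takeWhileD)
qed

text \<open>The renaming \<open>\<xi>\<close> moves the auxiliary symbols of the machine for \<open>f\<close> too.  This is why \<open>\<Delta>\<close> has to
  avoid the whole range of \<open>\<xi>\<close> and not only the image of \<open>\<Sigma>\<close>: a symbol of \<open>\<Delta>\<close> on
  the tape must always be a simulated left-end marker.\<close>

theorem pf_linear_time_computable_on_suffix:
  assumes "pf_linear_time_computable \<Sigma> f" and \<Delta>: "finite \<Delta>" "\<Delta> \<inter> range \<xi> = {}" and \<xi>: "inj \<xi>"
  shows "pf_linear_time_computable (\<xi> ` \<Sigma> \<union> \<Delta>) (on_suffix (\<xi> ` \<Sigma>) (map \<xi> \<circ> f \<circ> map (inv_into UNIV \<xi>)))"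
proof -
  let ?f = "map \<xi> \<circ> f \<circ> map (inv_into UNIV \<xi>)"
  obtain M :: "(nat, nat) pf_tm" and a b where M: "wf_pf_tm \<Sigma> M"
      "computes_within M \<Sigma> f (\<lambda>n. a * n + b)" and f: "f ` lists \<Sigma> \<subseteq> lists \<Sigma>"
    using assms unfolding pf_linear_time_computable_def by blast
  define M' where "M' = rename_tm id \<xi> M"
  have wf: "wf_pf_tm (\<xi> ` \<Sigma>) M'"
    unfolding M'_def by (rule wf_rename_tm[OF M(1)]) (use \<xi> in \<open>auto intro: inj_on_subset\<close>)
  have comp: "computes_within M' (\<xi> ` \<Sigma>) ?f (\<lambda>n. a * n + b)"
    unfolding M'_def
    by (rule computes_within_rename_tm[OF M(1) _ _ M(2)]) (use \<xi> in \<open>auto intro: inj_on_subset\<close>)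
  have f': "?f v \<in> lists (\<xi> ` \<Sigma>)" if v: "v \<in> lists (\<xi> ` \<Sigma>)" for v
  proof -
    obtain x where x: "x \<in> lists \<Sigma>" "v = map \<xi> x"
      using v by (rule lists_imageE)
    then have "?f v = map \<xi> (f x)" using \<xi> by simp
    moreover have "f x \<in> lists \<Sigma>" using f x(1) by blast
    ultimately show ?thesis by auto
  qed
  have split: "\<exists>u v. w = u @ v \<and> (u = [] \<or> last u \<in> \<Delta>) \<and> u \<in> lists (\<xi> ` \<Sigma> \<union> \<Delta>) \<and>
      v \<in> lists (\<xi> ` \<Sigma>) \<and> on_suffix (\<xi> ` \<Sigma>) ?f w = u @ ?f v"
    if w: "w \<in> lists (\<xi> ` \<Sigma> \<union> \<Delta>)" for w
  proof -
    obtain u v where uv: "w = u @ v" "u = [] \<or> last u \<notin> \<xi> ` \<Sigma>" "v \<in> lists (\<xi> ` \<Sigma>)"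
      by (rule split_at_suffix)
    moreover have "u \<in> lists (\<xi> ` \<Sigma> \<union> \<Delta>)" using w uv(1) by auto
    moreover from this have "u = [] \<or> last u \<in> \<Delta>"
      using uv(2) last_in_set[of u] by (auto simp del: last_in_set)
    ultimately show ?thesis using on_suffix_append by blast
  qed
  have "computes_within (suffix_tm M' \<Delta>) (\<xi> ` \<Sigma> \<union> \<Delta>) (on_suffix (\<xi> ` \<Sigma>) ?f)
      (\<lambda>n. (a + 2) * n + (b + 3))"
    unfolding computes_within_iff_reaches
  proof
    fix w assume "w \<in> lists (\<xi> ` \<Sigma> \<union> \<Delta>)"
    then obtain u v where uv: "w = u @ v" "u = [] \<or> last u \<in> \<Delta>" "v \<in> lists (\<xi> ` \<Sigma>)"
        "on_suffix (\<xi> ` \<Sigma>) ?f w = u @ ?f v"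
      using split by blast
    obtain c where c: "reaches M' (initial_config M' v) (a * length v + b) c"
        "accepting_halt M' c" "has_output c (?f v)"
      using comp uv(3) unfolding computes_within_iff_reaches by blast
    have "\<Delta> \<inter> tm_symbols M' = {}" using \<Delta>(2) by (auto simp: M'_def rename_tm_def)
    from suffix_tm_computes[OF wf this uv(2,3) c] obtain d where
      d: "reaches (suffix_tm M' \<Delta>) (initial_config (suffix_tm M' \<Delta>) w)
            (length w + length v + 3 + (a * length v + b)) d"
        "accepting_halt (suffix_tm M' \<Delta>) d" "has_output d (on_suffix (\<xi> ` \<Sigma>) ?f w)"
      using uv(1,4) by metis
    have "length v \<le> length w" using uv(1) by simp
    moreover from this have "a * length v \<le> a * length w" by simp
    ultimately have "length w + length v + 3 + (a * length v + b) \<le> (a + 2) * length w + (b + 3)"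
      unfolding distrib_right by linarith
    then show "\<exists>d. reaches (suffix_tm M' \<Delta>) (initial_config (suffix_tm M' \<Delta>) w)
          ((a + 2) * length w + (b + 3)) d \<and>
        accepting_halt (suffix_tm M' \<Delta>) d \<and> has_output d (on_suffix (\<xi> ` \<Sigma>) ?f w)"
      using d reaches_mono by blast
  qed
  moreover have "on_suffix (\<xi> ` \<Sigma>) ?f w \<in> lists (\<xi> ` \<Sigma> \<union> \<Delta>)" if "w \<in> lists (\<xi> ` \<Sigma> \<union> \<Delta>)" for w
    using split[OF that] f' by fastforce
  ultimately show ?thesis
    using wf_suffix_tm[OF wf \<Delta>(1)] by (rule pf_linear_time_computableI[rotated])
qed

section \<open>The free product is a group\<close>

text \<open>The embedding of a factor into the free product, with \<open>\<iota>\<close> being \<open>Inl\<close> or \<open>Inr\<close>.  The neutral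
  element gives the empty word, which makes this a homomorphism.\<close>

definition syllable :: "('g, 'k) monoid_scheme \<Rightarrow> ('g \<Rightarrow> 'c) \<Rightarrow> 'g \<Rightarrow> 'c list" where
  "syllable K \<iota> g = (if g = \<one>\<^bsub>K\<^esub> then [] else [\<iota> g])"

lemma syllable_one [simp]: "syllable K \<iota> \<one>\<^bsub>K\<^esub> = []"
  by (simp add: syllable_def)

locale free_factors = G: group G + H: group H
  for G :: "('a, 'm) monoid_scheme" and H :: "('b, 'n) monoid_scheme"
begin

abbreviation FP :: "('a + 'b) list monoid" where
  "FP \<equiv> free_product G H"

definition letters :: "('a + 'b) set" where
  "letters = Inl ` (carrier G - {\<one>\<^bsub>G\<^esub>}) \<union> Inr ` (carrier H - {\<one>\<^bsub>H\<^esub>})"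

lemma letters_simps [simp]:
  "Inl g \<in> letters \<longleftrightarrow> g \<in> carrier G \<and> g \<noteq> \<one>\<^bsub>G\<^esub>"
  "Inr h \<in> letters \<longleftrightarrow> h \<in> carrier H \<and> h \<noteq> \<one>\<^bsub>H\<^esub>"
  by (auto simp: letters_def)

lemma mult_FP: "u \<otimes>\<^bsub>FP\<^esub> v = foldr (fp_cons G H) u v"
  by (simp add: free_product_def)

lemma one_FP: "\<one>\<^bsub>FP\<^esub> = []"
  by (simp add: free_product_def)

lemma carrier_FP:
  "w \<in> carrier FP \<longleftrightarrow> set w \<subseteq> letters \<and> successively (\<lambda>x y. isl x \<noteq> isl y) w"
  by (simp add: free_product_def letters_def)

lemma Nil_in_FP [simp]: "[] \<in> carrier FP"
  by (simp add: carrier_FP)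

lemma set_subset_letters: "w \<in> carrier FP \<Longrightarrow> set w \<subseteq> letters"
  by (simp add: carrier_FP)

lemma Cons_in_FP:
  "x # w \<in> carrier FP \<longleftrightarrow> x \<in> letters \<and> w \<in> carrier FP \<and> (w = [] \<or> isl (hd w) \<noteq> isl x)"
  by (auto simp: carrier_FP successively_Cons)

lemma append_in_FP:
  "u @ v \<in> carrier FP \<longleftrightarrow>
     u \<in> carrier FP \<and> v \<in> carrier FP \<and> (u = [] \<or> v = [] \<or> isl (last u) \<noteq> isl (hd v))"
  by (auto simp: carrier_FP successively_append_iff)

lemma fp_cons_reduced:
  "x # w \<in> carrier FP \<Longrightarrow> fp_cons G H x w = x # w"
  by (cases "(G, H, x, w)" rule: fp_cons.cases) (auto simp: Cons_in_FP)

lemma fp_cons_closed: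
  assumes "x \<in> letters" "w \<in> carrier FP"
  shows "fp_cons G H x w \<in> carrier FP"
  using assms
  by (cases "(G, H, x, w)" rule: fp_cons.cases) (auto simp: Cons_in_FP)

lemma foldr_fp_cons_closed:
  "set u \<subseteq> letters \<Longrightarrow> w \<in> carrier FP \<Longrightarrow> foldr (fp_cons G H) u w \<in> carrier FP"
  by (induction u) (auto intro: fp_cons_closed)

lemma foldr_fp_cons_reduced:
  "u @ v \<in> carrier FP \<Longrightarrow> foldr (fp_cons G H) u v = u @ v"
  by (induction u) (auto simp: fp_cons_reduced Cons_in_FP)

lemma syllable_Inl_in_FP [simp]: "g \<in> carrier G \<Longrightarrow> syllable G Inl g \<in> carrier FP"
  and syllable_Inr_in_FP [simp]: "h \<in> carrier H \<Longrightarrow> syllable H Inr h \<in> carrier FP"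
  by (auto simp: syllable_def Cons_in_FP)

text \<open>The only place where associativity of the free product has content: a factor acts on the reduced
  words by prepending its elements, and two successive letters act like their product.  The cases
  arise from the cancellations that can occur when \<open>w\<close> begins with a letter of the same factor.\<close>

lemma fp_cons_Inl_Inl:
  assumes "w \<in> carrier FP" "a \<in> carrier G" "b \<in> carrier G" "a \<noteq> \<one>\<^bsub>G\<^esub>" "b \<noteq> \<one>\<^bsub>G\<^esub>"
  shows "fp_cons G H (Inl a) (fp_cons G H (Inl b) w) =
    foldr (fp_cons G H) (syllable G Inl (a \<otimes>\<^bsub>G\<^esub> b)) w"
proof (cases "\<exists>c w'. w = Inl c # w'")
  case True
  then obtain c w' where w: "w = Inl c # w'" by blast
  have c: "c \<in> carrier G" "c \<noteq> \<one>\<^bsub>G\<^esub>" and w': "w' \<in> carrier FP" "w' = [] \<or> \<not> isl (hd w')"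
    using assms(1) w by (auto simp: Cons_in_FP)
  have red: "fp_cons G H (Inl x) w' = Inl x # w'" for x
    using w'(2) by (cases w'; cases "hd w'") auto
  have assoc: "a \<otimes>\<^bsub>G\<^esub> b \<otimes>\<^bsub>G\<^esub> c = a \<otimes>\<^bsub>G\<^esub> (b \<otimes>\<^bsub>G\<^esub> c)"
    using assms c by (simp add: G.m_assoc)
  show ?thesis
  proof (cases "b \<otimes>\<^bsub>G\<^esub> c = \<one>\<^bsub>G\<^esub>")
    case True
    then have "a \<otimes>\<^bsub>G\<^esub> b \<otimes>\<^bsub>G\<^esub> c = a" using assoc assms by simp
    moreover from this have "a = c" if "a \<otimes>\<^bsub>G\<^esub> b = \<one>\<^bsub>G\<^esub>" using that c by simp
    ultimately show ?thesis using True assms red w by (auto simp: syllable_def)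
  next
    case False
    moreover from this have "a \<otimes>\<^bsub>G\<^esub> b \<noteq> \<one>\<^bsub>G\<^esub>" if "a \<otimes>\<^bsub>G\<^esub> (b \<otimes>\<^bsub>G\<^esub> c) = \<one>\<^bsub>G\<^esub>"
      using that assoc c by auto
    moreover have "a \<otimes>\<^bsub>G\<^esub> (b \<otimes>\<^bsub>G\<^esub> c) = c" if "a \<otimes>\<^bsub>G\<^esub> b = \<one>\<^bsub>G\<^esub>"
      using that assoc c by auto
    ultimately show ?thesis using assoc w by (auto simp: syllable_def)
  qed
next
  case False
  then have "fp_cons G H (Inl x) w = Inl x # w" for x
    by (cases w; cases "hd w") auto
  then show ?thesis by (simp add: syllable_def)
qed

lemma fp_cons_Inr_Inr:
  assumes "w \<in> carrier FP" "a \<in> carrier H" "b \<in> carrier H" "a \<noteq> \<one>\<^bsub>H\<^esub>" "b \<noteq> \<one>\<^bsub>H\<^esub>"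
  shows "fp_cons G H (Inr a) (fp_cons G H (Inr b) w) =
    foldr (fp_cons G H) (syllable H Inr (a \<otimes>\<^bsub>H\<^esub> b)) w"
proof (cases "\<exists>c w'. w = Inr c # w'")
  case True
  then obtain c w' where w: "w = Inr c # w'" by blast
  have c: "c \<in> carrier H" "c \<noteq> \<one>\<^bsub>H\<^esub>" and w': "w' \<in> carrier FP" "w' = [] \<or> isl (hd w')"
    using assms(1) w by (auto simp: Cons_in_FP)
  have red: "fp_cons G H (Inr x) w' = Inr x # w'" for x
    using w'(2) by (cases w'; cases "hd w'") auto
  have assoc: "a \<otimes>\<^bsub>H\<^esub> b \<otimes>\<^bsub>H\<^esub> c = a \<otimes>\<^bsub>H\<^esub> (b \<otimes>\<^bsub>H\<^esub> c)"
    using assms c by (simp add: H.m_assoc)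
  show ?thesis
  proof (cases "b \<otimes>\<^bsub>H\<^esub> c = \<one>\<^bsub>H\<^esub>")
    case True
    then have "a \<otimes>\<^bsub>H\<^esub> b \<otimes>\<^bsub>H\<^esub> c = a" using assoc assms by simp
    moreover from this have "a = c" if "a \<otimes>\<^bsub>H\<^esub> b = \<one>\<^bsub>H\<^esub>" using that c by simp
    ultimately show ?thesis using True assms red w by (auto simp: syllable_def)
  next
    case False
    moreover from this have "a \<otimes>\<^bsub>H\<^esub> b \<noteq> \<one>\<^bsub>H\<^esub>" if "a \<otimes>\<^bsub>H\<^esub> (b \<otimes>\<^bsub>H\<^esub> c) = \<one>\<^bsub>H\<^esub>"
      using that assoc c by auto
    moreover have "a \<otimes>\<^bsub>H\<^esub> (b \<otimes>\<^bsub>H\<^esub> c) = c" if "a \<otimes>\<^bsub>H\<^esub> b = \<one>\<^bsub>H\<^esub>"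
      using that assoc c by auto
    ultimately show ?thesis using assoc w by (auto simp: syllable_def)
  qed
next
  case False
  then have "fp_cons G H (Inr x) w = Inr x # w" for x
    by (cases w; cases "hd w") auto
  then show ?thesis by (simp add: syllable_def)
qed

lemma foldr_fp_cons_fp_cons:
  assumes "x \<in> letters" "v \<in> carrier FP" "w \<in> carrier FP"
  shows "foldr (fp_cons G H) (fp_cons G H x v) w = fp_cons G H x (foldr (fp_cons G H) v w)"
proof -
  consider a b v' where "x = Inl a" "v = Inl b # v'" | a b v' where "x = Inr a" "v = Inr b # v'"
    | "fp_cons G H x v = x # v"
    by (cases "(G, H, x, v)" rule: fp_cons.cases) auto
  then show ?thesis
  proof cases
    case (1 a b v')
    then have "v' \<in> carrier FP" using assms(2) by (simp add: Cons_in_FP)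
    then have "foldr (fp_cons G H) v' w \<in> carrier FP"
      by (intro foldr_fp_cons_closed set_subset_letters assms(3))
    then show ?thesis
      using 1 assms fp_cons_Inl_Inl[of "foldr (fp_cons G H) v' w" a b]
      by (auto simp: Cons_in_FP syllable_def)
  next
    case (2 a b v')
    then have "v' \<in> carrier FP" using assms(2) by (simp add: Cons_in_FP)
    then have "foldr (fp_cons G H) v' w \<in> carrier FP"
      by (intro foldr_fp_cons_closed set_subset_letters assms(3))
    then show ?thesis
      using 2 assms fp_cons_Inr_Inr[of "foldr (fp_cons G H) v' w" a b]
      by (auto simp: Cons_in_FP syllable_def)
  qed simp
qed

lemma foldr_fp_cons_assoc:
  assumes "set u \<subseteq> letters" "v \<in> carrier FP" "w \<in> carrier FP"
  shows "foldr (fp_cons G H) (foldr (fp_cons G H) u v) w =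
    foldr (fp_cons G H) u (foldr (fp_cons G H) v w)"
  using assms(1)
  by (induction u) (auto simp: foldr_fp_cons_fp_cons foldr_fp_cons_closed assms)

lemma FP_monoid: "monoid FP"
proof (rule monoidI)
  fix u v w assume uvw: "u \<in> carrier FP" "v \<in> carrier FP" "w \<in> carrier FP"
  show "u \<otimes>\<^bsub>FP\<^esub> v \<in> carrier FP"
    unfolding mult_FP using uvw by (intro foldr_fp_cons_closed set_subset_letters)
  show "u \<otimes>\<^bsub>FP\<^esub> v \<otimes>\<^bsub>FP\<^esub> w = u \<otimes>\<^bsub>FP\<^esub> (v \<otimes>\<^bsub>FP\<^esub> w)"
    unfolding mult_FP using uvw by (intro foldr_fp_cons_assoc set_subset_letters)
  show "u \<otimes>\<^bsub>FP\<^esub> \<one>\<^bsub>FP\<^esub> = u"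
    using uvw foldr_fp_cons_reduced[of u "[]"] by (simp add: mult_FP one_FP)
qed (simp_all add: mult_FP one_FP)

sublocale FP: monoid FP
  by (rule FP_monoid)

lemma syllable_Inl_mult:
  assumes "a \<in> carrier G" "b \<in> carrier G"
  shows "syllable G Inl a \<otimes>\<^bsub>FP\<^esub> syllable G Inl b = syllable G Inl (a \<otimes>\<^bsub>G\<^esub> b)"
  using assms by (simp add: syllable_def mult_FP)

lemma syllable_Inr_mult:
  assumes "a \<in> carrier H" "b \<in> carrier H"
  shows "syllable H Inr a \<otimes>\<^bsub>FP\<^esub> syllable H Inr b = syllable H Inr (a \<otimes>\<^bsub>H\<^esub> b)"
  using assms by (simp add: syllable_def mult_FP)

lemma Cons_eq_mult:
  assumes "x # w \<in> carrier FP"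
  shows "x # w = [x] \<otimes>\<^bsub>FP\<^esub> w"
  using fp_cons_reduced[OF assms] by (simp add: mult_FP)

lemma letter_cases:
  assumes "x \<in> letters"
  obtains g where "g \<in> carrier G" "[x] = syllable G Inl g"
  | h where "h \<in> carrier H" "[x] = syllable H Inr h"
  using assms by (cases x) (auto simp: syllable_def)

text \<open>If \<open>v\<close> is a left inverse of \<open>w\<close> and \<open>y\<close> one of \<open>[x]\<close>, then \<open>v \<otimes> y\<close> is one of \<open>x # w\<close>.\<close>

lemma FP_left_inverse: "w \<in> carrier FP \<Longrightarrow> \<exists>v \<in> carrier FP. v \<otimes>\<^bsub>FP\<^esub> w = \<one>\<^bsub>FP\<^esub>"
proof (induction w)
  case Nil
  show ?case by (intro bexI[of _ "[]"]) (simp_all add: mult_FP one_FP)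
next
  case (Cons x w)
  have x: "x \<in> letters" "[x] \<in> carrier FP" and w: "w \<in> carrier FP"
    using Cons.prems by (auto simp: Cons_in_FP)
  obtain v where v: "v \<in> carrier FP" "v \<otimes>\<^bsub>FP\<^esub> w = \<one>\<^bsub>FP\<^esub>"
    using Cons.IH w by blast
  obtain y where y: "y \<in> carrier FP" "y \<otimes>\<^bsub>FP\<^esub> [x] = \<one>\<^bsub>FP\<^esub>"
    using x(1)
  proof (cases rule: letter_cases)
    case (1 g)
    then show ?thesis
      using that[of "syllable G Inl (inv\<^bsub>G\<^esub> g)"] by (simp add: syllable_Inl_mult one_FP)
  next
    case (2 h)
    then show ?thesis
      using that[of "syllable H Inr (inv\<^bsub>H\<^esub> h)"] by (simp add: syllable_Inr_mult one_FP)
  qed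
  have "(v \<otimes>\<^bsub>FP\<^esub> y) \<otimes>\<^bsub>FP\<^esub> (x # w) = v \<otimes>\<^bsub>FP\<^esub> (y \<otimes>\<^bsub>FP\<^esub> [x] \<otimes>\<^bsub>FP\<^esub> w)"
    unfolding Cons_eq_mult[OF Cons.prems] using v(1) y(1) x w
    by (simp only: FP.m_assoc FP.m_closed)
  also have "\<dots> = \<one>\<^bsub>FP\<^esub>" using v w y by simp
  finally show ?case using v y by (intro bexI[of _ "v \<otimes>\<^bsub>FP\<^esub> y"]) simp_all
qed

lemma FP_group: "group FP"
proof (rule groupI)
  show "\<And>w. w \<in> carrier FP \<Longrightarrow> \<exists>v \<in> carrier FP. v \<otimes>\<^bsub>FP\<^esub> w = \<one>\<^bsub>FP\<^esub>"
    by (rule FP_left_inverse)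
qed (simp_all add: FP.m_assoc)

section \<open>Generators of the free product\<close>

lemma foldr_mult_append:
  assumes "set xs \<subseteq> carrier FP" "set ys \<subseteq> carrier FP"
  shows "foldr (\<otimes>\<^bsub>FP\<^esub>) (xs @ ys) \<one>\<^bsub>FP\<^esub> =
    foldr (\<otimes>\<^bsub>FP\<^esub>) xs \<one>\<^bsub>FP\<^esub> \<otimes>\<^bsub>FP\<^esub> foldr (\<otimes>\<^bsub>FP\<^esub>) ys \<one>\<^bsub>FP\<^esub>"
proof -
  have closed: "foldr (\<otimes>\<^bsub>FP\<^esub>) zs \<one>\<^bsub>FP\<^esub> \<in> carrier FP" if "set zs \<subseteq> carrier FP" for zs
    using that by (induction zs) simp_all
  show ?thesis
    using assms(1)
  proof (induction xs)
    case Nil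
    then show ?case using closed[OF assms(2)] by simp
  next
    case (Cons x xs)
    then show ?case using closed[of xs] closed[OF assms(2)] by (simp add: FP.m_assoc)
  qed
qed

text \<open>Syllables are homomorphic images of products of generators, and a reduced word is the product of its
  letters.  The empty word needs a nonempty product as well: it is the syllable of the neutral
  element of \<open>G\<close>.\<close>

lemma semigroup_generators_syllables:
  assumes S: "semigroup_generators G S" and T: "semigroup_generators H T"
  shows "semigroup_generators FP (syllable G Inl ` S \<union> syllable H Inr ` T)"
proof -
  let ?U = "syllable G Inl ` S \<union> syllable H Inr ` T"
  define gen where "gen w \<longleftrightarrow> (\<exists>xs. xs \<noteq> [] \<and> set xs \<subseteq> ?U \<and> w = foldr (\<otimes>\<^bsub>FP\<^esub>) xs \<one>\<^bsub>FP\<^esub>)" for w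
  have S': "S \<subseteq> carrier G" and T': "T \<subseteq> carrier H"
    using S T unfolding semigroup_generators_def by auto
  then have U: "?U \<subseteq> carrier FP" by auto
  have gen_mult: "gen (v \<otimes>\<^bsub>FP\<^esub> w)" if v: "gen v" and w: "gen w" for v w
  proof -
    obtain xs ys where xs: "xs \<noteq> []" "set xs \<subseteq> ?U" "v = foldr (\<otimes>\<^bsub>FP\<^esub>) xs \<one>\<^bsub>FP\<^esub>"
      and ys: "set ys \<subseteq> ?U" "w = foldr (\<otimes>\<^bsub>FP\<^esub>) ys \<one>\<^bsub>FP\<^esub>"
      using v w unfolding gen_def by blast
    have "v \<otimes>\<^bsub>FP\<^esub> w = foldr (\<otimes>\<^bsub>FP\<^esub>) (xs @ ys) \<one>\<^bsub>FP\<^esub>"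
      unfolding xs(3) ys(2)
      by (rule foldr_mult_append[symmetric, OF subset_trans[OF xs(2) U] subset_trans[OF ys(1) U]])
    then show ?thesis
      unfolding gen_def using xs(1,2) ys(1) by (intro exI[of _ "xs @ ys"] conjI) simp_all
  qed
  have gen_Inl: "gen (syllable G Inl g)" if g: "g \<in> carrier G" for g
  proof -
    obtain xs where xs: "xs \<noteq> []" "set xs \<subseteq> S" "g = foldr (\<otimes>\<^bsub>G\<^esub>) xs \<one>\<^bsub>G\<^esub>"
      using S g unfolding semigroup_generators_def by blast
    have "foldr (\<otimes>\<^bsub>G\<^esub>) ys \<one>\<^bsub>G\<^esub> \<in> carrier G \<and> syllable G Inl (foldr (\<otimes>\<^bsub>G\<^esub>) ys \<one>\<^bsub>G\<^esub>) =
        foldr (\<otimes>\<^bsub>FP\<^esub>) (map (syllable G Inl) ys) \<one>\<^bsub>FP\<^esub>" if "set ys \<subseteq> S" for ys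
      using that S' by (induction ys) (auto simp: one_FP syllable_Inl_mult[symmetric] subset_iff)
    then show ?thesis
      unfolding gen_def using xs by (intro exI[of _ "map (syllable G Inl) xs"]) auto
  qed
  have gen_Inr: "gen (syllable H Inr h)" if h: "h \<in> carrier H" for h
  proof -
    obtain xs where xs: "xs \<noteq> []" "set xs \<subseteq> T" "h = foldr (\<otimes>\<^bsub>H\<^esub>) xs \<one>\<^bsub>H\<^esub>"
      using T h unfolding semigroup_generators_def by blast
    have "foldr (\<otimes>\<^bsub>H\<^esub>) ys \<one>\<^bsub>H\<^esub> \<in> carrier H \<and> syllable H Inr (foldr (\<otimes>\<^bsub>H\<^esub>) ys \<one>\<^bsub>H\<^esub>) =
        foldr (\<otimes>\<^bsub>FP\<^esub>) (map (syllable H Inr) ys) \<one>\<^bsub>FP\<^esub>" if "set ys \<subseteq> T" for ys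
      using that T' by (induction ys) (auto simp: one_FP syllable_Inr_mult[symmetric] subset_iff)
    then show ?thesis
      unfolding gen_def using xs by (intro exI[of _ "map (syllable H Inr) xs"]) auto
  qed
  have "gen w" if "w \<in> carrier FP" for w
    using that
  proof (induction w)
    case Nil
    show ?case using gen_Inl[of "\<one>\<^bsub>G\<^esub>"] by simp
  next
    case (Cons x w)
    then have "gen w" "x \<in> letters" by (auto simp: Cons_in_FP)
    moreover from this(2) have "gen [x]"
      by (cases rule: letter_cases) (use gen_Inl gen_Inr in auto)
    ultimately show ?case
      using Cons_eq_mult[OF Cons.prems] gen_mult by metis
  qed
  then show ?thesis
    unfolding semigroup_generators_def gen_def using U by blast
qed

end

section \<open>Alternating concatenations of two languages\<close>

text \<open>The two languages swap their roles in every step, so one rule covers the words that begin with a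
  factor from either language; this matches the recursive structure of reduced words better than
  the expression with stars.\<close>

inductive alternating :: "'c list set \<Rightarrow> 'c list set \<Rightarrow> 'c list \<Rightarrow> bool" where
  alternating_Nil: "alternating A B []"
| alternating_append: "u \<in> A \<Longrightarrow> alternating B A v \<Longrightarrow> alternating A B (u @ v)"

lemma Nil_in_star [simp]: "[] \<in> star A"
  unfolding star_def by (rule image_eqI[of _ _ "[]"]) auto

lemma append_in_star: "u \<in> A \<Longrightarrow> v \<in> star A \<Longrightarrow> u @ v \<in> star A"
  unfolding star_def by (auto intro!: image_eqI[of _ _ "_ # _"])

lemma star_induct [consumes 1, case_names Nil append]:
  assumes "w \<in> star A" and "P []" and "\<And>u v. u \<in> A \<Longrightarrow> v \<in> star A \<Longrightarrow> P v \<Longrightarrow> P (u @ v)"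
  shows "P w"
proof -
  have "P (concat ws)" if "ws \<in> lists A" for ws
    using that by (induction ws) (use assms(2,3) in \<open>auto simp: star_def\<close>)
  then show ?thesis using assms(1) unfolding star_def by auto
qed

lemma append_in_conc: "u \<in> A \<Longrightarrow> v \<in> B \<Longrightarrow> u @ v \<in> A \<cdot> B"
  unfolding conc_def by blast

lemma concE:
  assumes "w \<in> A \<cdot> B" obtains u v where "w = u @ v" "u \<in> A" "v \<in> B"
  using assms unfolding conc_def by blast

lemma append_star_conc:
  assumes "a \<in> A" "w \<in> star (B \<cdot> A)"
  shows "a @ w \<in> star (A \<cdot> B) \<cdot> A"
  using assms(2,1)
proof (induction arbitrary: a rule: star_induct)
  case Nil
  then show ?case using append_in_conc[OF Nil_in_star, of a A] by simp
next
  case (append u v)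
  obtain b a' where u: "u = b @ a'" "b \<in> B" "a' \<in> A" using append.hyps(1) by (rule concE)
  obtain x y where xy: "a' @ v = x @ y" "x \<in> star (A \<cdot> B)" "y \<in> A"
    using append.IH[OF u(3)] by (rule concE)
  have "(a @ b) @ x \<in> star (A \<cdot> B)"
    using append.prems u xy by (intro append_in_star append_in_conc)
  then have "((a @ b) @ x) @ y \<in> star (A \<cdot> B) \<cdot> A" using xy(3) by (rule append_in_conc)
  moreover have "a @ u @ v = ((a @ b) @ x) @ y" using u(1) xy(1) by simp
  ultimately show ?case by simp
qed

lemma star_append:
  assumes "u \<in> star A" "v \<in> star A"
  shows "u @ v \<in> star A"
  using assms(1) by (induction rule: star_induct) (use assms(2) in \<open>auto intro: append_in_star\<close>)

lemma append_star_conc':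
  assumes "a \<in> A" "w \<in> star (B \<cdot> A) \<cdot> B"
  shows "a @ w \<in> star (A \<cdot> B)"
proof -
  obtain u b where w: "w = u @ b" "u \<in> star (B \<cdot> A)" "b \<in> B" using assms(2) by (rule concE)
  obtain x y where xy: "a @ u = x @ y" "x \<in> star (A \<cdot> B)" "y \<in> A"
    using append_star_conc[OF assms(1) w(2)] by (rule concE)
  have "(y @ b) @ [] \<in> star (A \<cdot> B)"
    using xy w by (intro append_in_star append_in_conc Nil_in_star)
  then have "x @ (y @ b) \<in> star (A \<cdot> B)" using xy star_append by simp
  moreover have "a @ w = x @ (y @ b)" using w(1) xy(1) by (metis append_assoc)
  ultimately show ?thesis by simp
qed

lemma alternating_star_append:
  assumes "w \<in> star (A \<cdot> B)" "alternating A B v"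
  shows "alternating A B (w @ v)"
  using assms(1)
proof (induction rule: star_induct)
  case Nil
  then show ?case using assms(2) by simp
next
  case (append u w)
  obtain a b where "u = a @ b" "a \<in> A" "b \<in> B" using append.hyps(1) by (rule concE)
  then show ?case
    using alternating_append[of a A B, OF _ alternating_append[of b B A, OF _ append.IH]] by simp
qed

lemma Collect_alternating: "Collect (alternating A B) = star (A \<cdot> B) \<union> star (A \<cdot> B) \<cdot> A"
proof (intro equalityI subsetI)
  fix w assume "w \<in> Collect (alternating A B)"
  then have "alternating A B w" by simp
  then show "w \<in> star (A \<cdot> B) \<union> star (A \<cdot> B) \<cdot> A"
    by induction (auto intro: append_star_conc append_star_conc')
next
  fix w assume "w \<in> star (A \<cdot> B) \<union> star (A \<cdot> B) \<cdot> A"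
  moreover have "alternating A B a" if "a \<in> A" for a
    using alternating_append[OF that alternating_Nil] by simp
  ultimately show "w \<in> Collect (alternating A B)"
    using alternating_star_append[OF _ alternating_Nil, of w A B]
    by (auto elim!: concE intro: alternating_star_append)
qed

section \<open>Representing the neutral element by the empty word\<close>

text \<open>If the empty word represents \<open>g\<close>, translating the representation by \<open>g\<close> on the left commutes with the
  right multiplications and makes the empty word represent the neutral element.
  Otherwise the representative of the neutral element is replaced by the empty word.  This changes the
  right multiplication by \<open>s\<close> at two arguments only: at the new word, and at the
  representative of the inverse of \<open>s\<close>, whose value is the neutral element.\<close>

lemma cayley_normal_form:
  fixes \<C> :: "nat list set set" and G :: "('a, 'm) monoid_scheme"
  assumes eps: "\<And>L w. L \<in> \<C> \<Longrightarrow> L \<noteq> {} \<Longrightarrow> [] \<notin> L \<Longrightarrow> w \<in> L \<Longrightarrow> (L - {w}) \<union> {[]} \<in> \<C>"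
    and cayley: "cayley_pf_linear_time_computable \<C> G"
  obtains S \<Sigma> \<chi> where "finite S" "semigroup_generators G S" "finite \<Sigma>" "\<chi> ` carrier G \<in> \<C>"
    "\<chi> ` carrier G \<subseteq> lists \<Sigma>" "inj_on \<chi> (carrier G)" "\<chi> \<one>\<^bsub>G\<^esub> = []"
    "\<And>s. s \<in> S \<Longrightarrow> \<exists>f. pf_linear_time_computable \<Sigma> f \<and> (\<forall>g \<in> carrier G. f (\<chi> g) = \<chi> (g \<otimes>\<^bsub>G\<^esub> s))"
proof -
  interpret G: group G
    using cayley by (simp add: cayley_pf_linear_time_computable_def)
  obtain S \<Sigma> L \<psi> where S: "finite S" "semigroup_generators G S" and \<Sigma>: "finite \<Sigma>" "L \<subseteq> lists \<Sigma>"
    and L: "L \<in> \<C>" and \<psi>: "bij_betw \<psi> L (carrier G)"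
    and f: "\<forall>s \<in> S. \<exists>f. pf_linear_time_computable \<Sigma> f \<and> f ` L \<subseteq> L \<and>
                     (\<forall>w \<in> L. \<psi> (f w) = \<psi> w \<otimes>\<^bsub>G\<^esub> s)"
    using cayley unfolding cayley_pf_linear_time_computable_def
    by (elim conjE exE) (rule that; assumption)
  have S_carrier: "s \<in> carrier G" if "s \<in> S" for s
    using S(2) that unfolding semigroup_generators_def by blast
  define \<phi> where "\<phi> = inv_into L \<psi>"
  have \<phi>: "bij_betw \<phi> (carrier G) L"
    unfolding \<phi>_def by (rule bij_betw_inv_into[OF \<psi>])
  have \<phi>_in: "\<phi> g \<in> L" if "g \<in> carrier G" for g
    using \<phi> that by (rule bij_betw_apply)
  have \<phi>_\<psi>: "\<phi> (\<psi> w) = w" if "w \<in> L" for w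
    unfolding \<phi>_def by (rule bij_betw_inv_into_left[OF \<psi> that])
  have \<psi>_\<phi>: "\<psi> (\<phi> g) = g" if "g \<in> carrier G" for g
    unfolding \<phi>_def by (rule bij_betw_inv_into_right[OF \<psi> that])
  have mult: "f (\<phi> g) = \<phi> (g \<otimes>\<^bsub>G\<^esub> s)"
    if "f ` L \<subseteq> L" "\<forall>w \<in> L. \<psi> (f w) = \<psi> w \<otimes>\<^bsub>G\<^esub> s" "g \<in> carrier G" for f g s
  proof -
    have "f (\<phi> g) = \<phi> (\<psi> (f (\<phi> g)))" using \<phi>_\<psi>[of "f (\<phi> g)"] \<phi>_in[OF that(3)] that(1) by auto
    also have "\<psi> (f (\<phi> g)) = g \<otimes>\<^bsub>G\<^esub> s" using that(2,3) \<phi>_in \<psi>_\<phi> by simp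
    finally show ?thesis .
  qed
  show ?thesis
  proof (cases "[] \<in> L")
    case True
    define \<chi> where "\<chi> = \<phi> \<circ> (\<otimes>\<^bsub>G\<^esub>) (\<psi> [])"
    have g0: "\<psi> [] \<in> carrier G" using \<psi> True by (rule bij_betw_apply)
    have bij: "bij_betw \<chi> (carrier G) L"
      unfolding \<chi>_def
      by (rule bij_betw_trans[OF bij_betw_imageI \<phi>])
        (use g0 in \<open>auto simp: G.inj_on_cmult G.surj_const_mult\<close>)
    show ?thesis
    proof (rule that[OF S \<Sigma>(1), of \<chi>])
      show "\<chi> ` carrier G \<in> \<C>" "\<chi> ` carrier G \<subseteq> lists \<Sigma>" "inj_on \<chi> (carrier G)"
        using bij L \<Sigma>(2) by (simp_all add: bij_betw_def)
      show "\<chi> \<one>\<^bsub>G\<^esub> = []" using g0 True \<phi>_\<psi> by (simp add: \<chi>_def)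
      fix s assume s: "s \<in> S"
      obtain f where f: "pf_linear_time_computable \<Sigma> f" "f ` L \<subseteq> L"
          "\<forall>w \<in> L. \<psi> (f w) = \<psi> w \<otimes>\<^bsub>G\<^esub> s"
        using bspec[OF f s] by blast
      have "f (\<chi> g) = \<chi> (g \<otimes>\<^bsub>G\<^esub> s)" if "g \<in> carrier G" for g
        using mult[OF f(2,3), of "\<psi> [] \<otimes>\<^bsub>G\<^esub> g"] that g0 S_carrier[OF s]
        by (simp add: \<chi>_def G.m_assoc)
      then show "\<exists>f. pf_linear_time_computable \<Sigma> f \<and> (\<forall>g \<in> carrier G. f (\<chi> g) = \<chi> (g \<otimes>\<^bsub>G\<^esub> s))"
        using f(1) by blast
    qed
  next
    case False
    define \<chi> where "\<chi> = \<phi>(\<one>\<^bsub>G\<^esub> := [])"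
    have image: "\<chi> ` carrier G = (L - {\<phi> \<one>\<^bsub>G\<^esub>}) \<union> {[]}"
    proof -
      have "\<phi> ` (carrier G - {\<one>\<^bsub>G\<^esub>}) = L - {\<phi> \<one>\<^bsub>G\<^esub>}"
        using \<phi> by (simp add: bij_betw_def inj_on_image_set_diff[of _ "carrier G"])
      moreover have "\<chi> ` carrier G = \<phi> ` (carrier G - {\<one>\<^bsub>G\<^esub>}) \<union> {[]}"
        by (auto simp: \<chi>_def)
      ultimately show ?thesis by simp
    qed
    have inj: "inj_on \<chi> (carrier G)"
    proof (rule inj_onI)
      fix g h assume "g \<in> carrier G" "h \<in> carrier G" "\<chi> g = \<chi> h"
      then show "g = h"
        using \<phi>_in[of g] \<phi>_in[of h] False \<phi> by (auto simp: \<chi>_def bij_betw_def inj_on_def split: if_splits)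
    qed
    show ?thesis
    proof (rule that[OF S \<Sigma>(1), of \<chi>])
      show "\<chi> ` carrier G \<in> \<C>"
        unfolding image using \<phi>_in[OF G.one_closed] by (intro eps L False) auto
      show lists: "\<chi> ` carrier G \<subseteq> lists \<Sigma>" unfolding image using \<Sigma>(2) by auto
      show "inj_on \<chi> (carrier G)" by (rule inj)
      show "\<chi> \<one>\<^bsub>G\<^esub> = []" by (simp add: \<chi>_def)
      fix s assume s: "s \<in> S"
      then have sG: "s \<in> carrier G" by (rule S_carrier)
      obtain f where f: "pf_linear_time_computable \<Sigma> f" "f ` L \<subseteq> L"
          "\<forall>w \<in> L. \<psi> (f w) = \<psi> w \<otimes>\<^bsub>G\<^esub> s"
        using bspec[OF f s] by blast
      define f' where "f' = (f(\<phi> (inv\<^bsub>G\<^esub> s) := []))([] := \<chi> s)"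
      have "pf_linear_time_computable \<Sigma> f'"
        unfolding f'_def using lists sG
        by (intro pf_linear_time_computable_fun_upd f(1)) auto
      moreover have "f' (\<chi> g) = \<chi> (g \<otimes>\<^bsub>G\<^esub> s)" if g: "g \<in> carrier G" for g
      proof (cases "g = \<one>\<^bsub>G\<^esub>")
        case True
        then show ?thesis using sG by (simp add: f'_def \<chi>_def)
      next
        case g1: False
        have "\<phi> g \<noteq> []" using \<phi>_in[OF g] False by auto
        show ?thesis
        proof (cases "g = inv\<^bsub>G\<^esub> s")
          case True
          then show ?thesis using g1 \<open>\<phi> g \<noteq> []\<close> sG by (simp add: f'_def \<chi>_def)
        next
          case False
          then have "\<phi> g \<noteq> \<phi> (inv\<^bsub>G\<^esub> s)" using \<psi>_\<phi> g sG by (metis G.inv_closed)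
          moreover have "g \<otimes>\<^bsub>G\<^esub> s \<noteq> \<one>\<^bsub>G\<^esub>" using False g sG G.inv_equality by metis
          ultimately show ?thesis
            using g1 \<open>\<phi> g \<noteq> []\<close> mult[OF f(2,3) g] by (simp add: f'_def \<chi>_def)
        qed
      qed
      ultimately show "\<exists>f. pf_linear_time_computable \<Sigma> f \<and> (\<forall>g \<in> carrier G. f (\<chi> g) = \<chi> (g \<otimes>\<^bsub>G\<^esub> s))"
        by blast
    qed
  qed
qed

section \<open>Encoding reduced words by concatenation\<close>

text \<open>Unique readability: the boundary of the first block is where the alphabet changes.\<close>

lemma block_append_eq_iff:
  assumes "u \<in> lists A" "u' \<in> lists A" "v = [] \<or> hd v \<notin> A" "v' = [] \<or> hd v' \<notin> A"
  shows "u @ v = u' @ v' \<longleftrightarrow> u = u' \<and> v = v'"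
proof
  have block: "takeWhile (\<lambda>c. c \<in> A) (x @ y) = x" if "x \<in> lists A" "y = [] \<or> hd y \<notin> A" for x y
  proof -
    have "takeWhile (\<lambda>c. c \<in> A) y = []" using that(2) by (cases y) auto
    then show ?thesis using that(1) by (subst takeWhile_append2) auto
  qed
  assume eq: "u @ v = u' @ v'"
  then have "u = u'" using block[OF assms(1,3)] block[OF assms(2,4)] by simp
  then show "u = u' \<and> v = v'" using eq by simp
qed simp

locale factor_encodings = free_factors G H
  for G :: "('a, 'm) monoid_scheme" and H :: "('b, 'n) monoid_scheme" +
  fixes \<Sigma> \<Delta> :: "'c set" and \<gamma> :: "'a \<Rightarrow> 'c list" and \<eta> :: "'b \<Rightarrow> 'c list"
  assumes disjoint: "\<Sigma> \<inter> \<Delta> = {}"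
    and \<gamma>_lists: "\<gamma> ` carrier G \<subseteq> lists \<Sigma>" and \<gamma>_inj: "inj_on \<gamma> (carrier G)"
    and \<gamma>_one: "\<gamma> \<one>\<^bsub>G\<^esub> = []"
    and \<eta>_lists: "\<eta> ` carrier H \<subseteq> lists \<Delta>" and \<eta>_inj: "inj_on \<eta> (carrier H)"
    and \<eta>_one: "\<eta> \<one>\<^bsub>H\<^esub> = []"
begin

definition encode :: "('a + 'b) list \<Rightarrow> 'c list" where
  "encode w = concat (map (case_sum \<gamma> \<eta>) w)"

lemma encode_simps [simp]:
  "encode [] = []"
  "encode (Inl g # w) = \<gamma> g @ encode w"
  "encode (Inr h # w) = \<eta> h @ encode w"
  "encode (u @ v) = encode u @ encode v"
  by (simp_all add: encode_def)

lemma encode_syllable_Inl: "encode (syllable G Inl g) = \<gamma> g"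
  and encode_syllable_Inr: "encode (syllable H Inr h) = \<eta> h"
  by (simp_all add: syllable_def \<gamma>_one \<eta>_one)

lemma \<gamma>_letter: "Inl g \<in> letters \<Longrightarrow> \<gamma> g \<in> lists \<Sigma> - {[]}"
  using \<gamma>_lists \<gamma>_inj[THEN inj_onD, of g "\<one>\<^bsub>G\<^esub>"] \<gamma>_one by auto

lemma \<eta>_letter: "Inr h \<in> letters \<Longrightarrow> \<eta> h \<in> lists \<Delta> - {[]}"
  using \<eta>_lists \<eta>_inj[THEN inj_onD, of h "\<one>\<^bsub>H\<^esub>"] \<eta>_one by auto

lemma encode_letter:
  assumes "x \<in> letters"
  shows "encode [x] \<in> lists (if isl x then \<Sigma> else \<Delta>)" "encode [x] \<noteq> []"
  using assms \<gamma>_letter \<eta>_letter by (cases x; simp)+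

lemma encode_Cons: "encode (x # w) = encode [x] @ encode w"
  by (simp add: encode_def)

lemma encode_in_lists: "w \<in> carrier FP \<Longrightarrow> encode w \<in> lists (\<Sigma> \<union> \<Delta>)"
proof (induction w)
  case (Cons x w)
  then have "encode w \<in> lists (\<Sigma> \<union> \<Delta>)" "encode [x] \<in> lists (\<Sigma> \<union> \<Delta>)"
    using encode_letter(1)[of x] by (auto simp: Cons_in_FP split: if_splits)
  then show ?case unfolding encode_Cons[of x w] by simp
qed simp

lemma hd_encode:
  assumes "w \<in> carrier FP" "w \<noteq> []"
  shows "encode w \<noteq> []" "hd (encode w) \<in> (if isl (hd w) then \<Sigma> else \<Delta>)"
proof -
  obtain x v where w: "w = x # v" using assms(2) by (cases w) simp_all
  note x = encode_letter[of x]
  have "x \<in> letters" using assms(1) w by (simp add: Cons_in_FP)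
  then show "encode w \<noteq> []" "hd (encode w) \<in> (if isl (hd w) then \<Sigma> else \<Delta>)"
    using x hd_in_set[of "encode [x]"] unfolding w encode_Cons[of x v] by (auto simp del: hd_in_set)
qed

lemma last_encode:
  assumes "w \<in> carrier FP" "w \<noteq> []"
  shows "last (encode w) \<in> (if isl (last w) then \<Sigma> else \<Delta>)"
proof -
  obtain x v where w: "w = v @ [x]" using assms(2) by (cases w rule: rev_cases) simp_all
  note x = encode_letter[of x]
  have "x \<in> letters" using assms(1) w by (simp add: append_in_FP Cons_in_FP)
  then show ?thesis
    using x last_in_set[of "encode [x]"] by (auto simp: w simp del: last_in_set)
qed

lemma inj_on_encode: "inj_on encode (carrier FP)"
proof (rule inj_onI)
  fix v w assume "v \<in> carrier FP" "w \<in> carrier FP" "encode v = encode w"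
  then show "v = w"
  proof (induction v arbitrary: w)
    case Nil
    then show ?case using hd_encode(1) by force
  next
    case (Cons x v)
    obtain y w' where w: "w = y # w'"
      using Cons.prems hd_encode(1)[of "x # v"] by (cases w) auto
    have v_in: "v \<in> carrier FP" "w' \<in> carrier FP" and letters: "x \<in> letters" "y \<in> letters"
      and alt: "v = [] \<or> isl (hd v) \<noteq> isl x" "w' = [] \<or> isl (hd w') \<noteq> isl y"
      using Cons.prems w by (auto simp: Cons_in_FP)
    have hd: "encode u = [] \<or> hd (encode u) \<notin> (if b then \<Sigma> else \<Delta>)"
      if "u \<in> carrier FP" "u = [] \<or> isl (hd u) \<noteq> b" for u b
      using hd_encode[OF that(1)] that(2) disjoint by (cases "u = []") (auto split: if_splits)
    have "isl x = isl y"
      using hd_encode(2)[of "x # v"] hd_encode(2)[of "y # w'"] Cons.prems w disjoint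
      by (auto split: if_splits)
    then have "encode [x] = encode [y] \<and> encode v = encode w'"
      using Cons.prems(3) hd[OF v_in(1) alt(1)] hd[OF v_in(2) alt(2)]
        encode_letter(1)[OF letters(1)] encode_letter(1)[OF letters(2)]
      unfolding w encode_Cons[of x v] encode_Cons[of y w']
      by (subst (asm) block_append_eq_iff[where A = "if isl x then \<Sigma> else \<Delta>"]) simp_all
    moreover from this have "x = y"
      using letters \<open>isl x = isl y\<close> \<gamma>_inj \<eta>_inj by (cases x; cases y) (auto dest: inj_onD)
    ultimately show ?case using Cons.IH[OF v_in] w by simp
  qed
qed

lemma alternating_encode:
  assumes "w \<in> carrier FP" and "A = \<gamma> ` carrier G - {[]}" "B = \<eta> ` carrier H - {[]}"
  shows "(w = [] \<or> isl (hd w) \<longrightarrow> alternating A B (encode w)) \<and>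
    (w = [] \<or> \<not> isl (hd w) \<longrightarrow> alternating B A (encode w))"
  using assms(1)
proof (induction w)
  case Nil
  show ?case by (simp add: alternating_Nil)
next
  case (Cons x w)
  then have "x \<in> letters" "w \<in> carrier FP" "w = [] \<or> isl (hd w) \<noteq> isl x" by (auto simp: Cons_in_FP)
  then show ?case
    using Cons.IH \<gamma>_letter \<eta>_letter
    by (cases x) (auto simp: assms(2,3) intro!: alternating_append)
qed

lemma alternating_decode:
  assumes "alternating X Y u" and "A = \<gamma> ` carrier G - {[]}" "B = \<eta> ` carrier H - {[]}"
  shows "(X = A \<and> Y = B \<longrightarrow> (\<exists>w \<in> carrier FP. (w = [] \<or> isl (hd w)) \<and> u = encode w)) \<and>
    (X = B \<and> Y = A \<longrightarrow> (\<exists>w \<in> carrier FP. (w = [] \<or> \<not> isl (hd w)) \<and> u = encode w))"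
  using assms(1)
proof induction
  case (alternating_Nil X Y)
  show ?case by (auto intro!: bexI[of _ "[]"])
next
  case (alternating_append u X Y v)
  show ?case
  proof (intro conjI impI)
    assume XY: "X = A \<and> Y = B"
    then obtain w where w: "w \<in> carrier FP" "w = [] \<or> \<not> isl (hd w)" "v = encode w"
      using alternating_append.IH by blast
    obtain g where g: "g \<in> carrier G" "u = \<gamma> g" "u \<noteq> []"
      using alternating_append.hyps(1) XY assms(2) by blast
    then have "g \<noteq> \<one>\<^bsub>G\<^esub>" using \<gamma>_one by auto
    then show "\<exists>w \<in> carrier FP. (w = [] \<or> isl (hd w)) \<and> u @ v = encode w"
      using g w by (intro bexI[of _ "Inl g # w"]) (auto simp: Cons_in_FP)
  next
    assume XY: "X = B \<and> Y = A"
    then obtain w where w: "w \<in> carrier FP" "w = [] \<or> isl (hd w)" "v = encode w"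
      using alternating_append.IH by blast
    obtain h where h: "h \<in> carrier H" "u = \<eta> h" "u \<noteq> []"
      using alternating_append.hyps(1) XY assms(3) by blast
    then have "h \<noteq> \<one>\<^bsub>H\<^esub>" using \<eta>_one by auto
    then show "\<exists>w \<in> carrier FP. (w = [] \<or> \<not> isl (hd w)) \<and> u @ v = encode w"
      using h w by (intro bexI[of _ "Inr h # w"]) (auto simp: Cons_in_FP)
  qed
qed

text \<open>An encoding is an alternating concatenation of nonempty words from the two languages because only
  the neutral elements have the empty word as representative, and they do not occur in reduced words.\<close>

lemma encode_image:
  assumes A: "A = \<gamma> ` carrier G - {[]}" and B: "B = \<eta> ` carrier H - {[]}"
  shows "encode ` carrier FP =
    star (A \<cdot> B) \<union> star (A \<cdot> B) \<cdot> A \<union> star (B \<cdot> A) \<union> star (B \<cdot> A) \<cdot> B \<union> {[]}"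
proof -
  have "encode ` carrier FP = Collect (alternating A B) \<union> Collect (alternating B A)"
    using alternating_encode[OF _ A B] alternating_decode[OF _ A B] by blast
  then show ?thesis unfolding Collect_alternating by auto
qed

text \<open>Multiplication by an element of \<open>G\<close> changes only the longest suffix over \<open>\<Sigma>\<close>.  When the word ends with
  a block over \<open>\<Delta>\<close>, or is empty, this suffix is the empty word, which represents the neutral element;
  when the product in \<open>G\<close> is neutral, the last block disappears by becoming empty.  So neither
  the creation nor the cancellation of a syllable is a special case.\<close>

lemma encode_mult_syllable_Inl:
  assumes w: "w \<in> carrier FP"
  obtains u g where "g \<in> carrier G" "u = [] \<or> last u \<in> \<Delta>" "encode w = u @ \<gamma> g"
    "\<And>s. s \<in> carrier G \<Longrightarrow> encode (w \<otimes>\<^bsub>FP\<^esub> syllable G Inl s) = u @ \<gamma> (g \<otimes>\<^bsub>G\<^esub> s)"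
proof -
  obtain v g where vg: "w = v @ syllable G Inl g" "g \<in> carrier G" "v = [] \<or> \<not> isl (last v)"
  proof (cases "w \<noteq> [] \<and> isl (last w)")
    case True
    then obtain v g where "w = v @ [Inl g]"
      by (cases w rule: rev_cases) (auto simp: isl_def)
    then show ?thesis
      using that[of v g] w by (auto simp: append_in_FP Cons_in_FP syllable_def)
  next
    case False
    then show ?thesis using that[of w "\<one>\<^bsub>G\<^esub>"] by auto
  qed
  have v: "v \<in> carrier FP" using w vg(1) by (simp add: append_in_FP)
  have "w \<otimes>\<^bsub>FP\<^esub> syllable G Inl s = v @ syllable G Inl (g \<otimes>\<^bsub>G\<^esub> s)" if s: "s \<in> carrier G" for s
  proof -
    have "w \<otimes>\<^bsub>FP\<^esub> syllable G Inl s = foldr (fp_cons G H) v (syllable G Inl (g \<otimes>\<^bsub>G\<^esub> s))"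
      using syllable_Inl_mult[OF vg(2) s] by (simp add: vg(1) mult_FP)
    also have "\<dots> = v @ syllable G Inl (g \<otimes>\<^bsub>G\<^esub> s)"
      using v vg s by (intro foldr_fp_cons_reduced) (auto simp: append_in_FP syllable_def Cons_in_FP)
    finally show ?thesis .
  qed
  moreover have "encode v = [] \<or> last (encode v) \<in> \<Delta>"
    using last_encode[OF v] vg(3) by (cases "v = []") auto
  ultimately show ?thesis
    using that[of g "encode v"] vg(1,2) by (simp add: encode_syllable_Inl)
qed

lemma encode_mult_syllable_Inr:
  assumes w: "w \<in> carrier FP"
  obtains u h where "h \<in> carrier H" "u = [] \<or> last u \<in> \<Sigma>" "encode w = u @ \<eta> h"
    "\<And>s. s \<in> carrier H \<Longrightarrow> encode (w \<otimes>\<^bsub>FP\<^esub> syllable H Inr s) = u @ \<eta> (h \<otimes>\<^bsub>H\<^esub> s)"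
proof -
  obtain v h where vh: "w = v @ syllable H Inr h" "h \<in> carrier H" "v = [] \<or> isl (last v)"
  proof (cases "w \<noteq> [] \<and> \<not> isl (last w)")
    case True
    then obtain v x where x: "w = v @ [x]" "\<not> isl x"
      by (cases w rule: rev_cases) auto
    then obtain h where "w = v @ [Inr h]" by (cases x) auto
    then show ?thesis
      using that[of v h] w by (auto simp: append_in_FP Cons_in_FP syllable_def)
  next
    case False
    then show ?thesis using that[of w "\<one>\<^bsub>H\<^esub>"] by auto
  qed
  have v: "v \<in> carrier FP" using w vh(1) by (simp add: append_in_FP)
  have "w \<otimes>\<^bsub>FP\<^esub> syllable H Inr s = v @ syllable H Inr (h \<otimes>\<^bsub>H\<^esub> s)" if s: "s \<in> carrier H" for s
  proof -
    have "w \<otimes>\<^bsub>FP\<^esub> syllable H Inr s = foldr (fp_cons G H) v (syllable H Inr (h \<otimes>\<^bsub>H\<^esub> s))"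
      using syllable_Inr_mult[OF vh(2) s] by (simp add: vh(1) mult_FP)
    also have "\<dots> = v @ syllable H Inr (h \<otimes>\<^bsub>H\<^esub> s)"
      using v vh s by (intro foldr_fp_cons_reduced) (auto simp: append_in_FP syllable_def Cons_in_FP)
    finally show ?thesis .
  qed
  moreover have "encode v = [] \<or> last (encode v) \<in> \<Sigma>"
    using last_encode[OF v] vh(3) by (cases "v = []") auto
  ultimately show ?thesis
    using that[of h "encode v"] vh(1,2) by (simp add: encode_syllable_Inr)
qed

end

section \<open>Multiplication in the free product is computed in linear time\<close>

lemma pf_linear_time_computable_right_mult:
  assumes f: "pf_linear_time_computable \<Sigma> f" and \<chi>: "\<chi> ` carrier K \<subseteq> lists \<Sigma>"
    and mult: "\<forall>g \<in> carrier K. f (\<chi> g) = \<chi> (g \<otimes>\<^bsub>K\<^esub> s)"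
    and \<Delta>: "finite \<Delta>" "\<Delta> \<inter> range \<xi> = {}" and \<xi>: "inj \<xi>"
  obtains F where "pf_linear_time_computable (\<xi> ` \<Sigma> \<union> \<Delta>) F"
    "\<And>u g. u = [] \<or> last u \<in> \<Delta> \<Longrightarrow> g \<in> carrier K \<Longrightarrow>
      F (u @ map \<xi> (\<chi> g)) = u @ map \<xi> (\<chi> (g \<otimes>\<^bsub>K\<^esub> s))"
proof
  let ?F = "on_suffix (\<xi> ` \<Sigma>) (map \<xi> \<circ> f \<circ> map (inv_into UNIV \<xi>))"
  show "pf_linear_time_computable (\<xi> ` \<Sigma> \<union> \<Delta>) ?F"
    by (rule pf_linear_time_computable_on_suffix[OF f \<Delta> \<xi>])
  fix u g assume u: "u = [] \<or> last u \<in> \<Delta>" and g: "g \<in> carrier K"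
  have "u = [] \<or> last u \<notin> \<xi> ` \<Sigma>" using u \<Delta>(2) by auto
  moreover have "map \<xi> (\<chi> g) \<in> lists (\<xi> ` \<Sigma>)"
    using g \<chi> by (simp only: lists_image) (rule imageI, blast)
  ultimately show "?F (u @ map \<xi> (\<chi> g)) = u @ map \<xi> (\<chi> (g \<otimes>\<^bsub>K\<^esub> s))"
    using mult g \<xi> by (simp add: on_suffix_append)
qed

lemma language_class_map:
  assumes "language_class \<C>" "finite \<Sigma>" "inj \<xi>" "L \<subseteq> lists \<Sigma>" "L \<in> \<C>"
  shows "map \<xi> ` L \<in> \<C>"
proof -
  have "bij_betw \<xi> \<Sigma> (\<xi> ` \<Sigma>)" using assms(3) by (auto intro: bij_betw_imageI inj_on_subset)
  then show ?thesis
    using assms unfolding language_class_def by (meson finite_imageI)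
qed

theorem theorem6:
  fixes \<C> :: "nat list set set"
    and G :: "('a, 'm) monoid_scheme"
    and H :: "('b, 'n) monoid_scheme"
  assumes "language_class \<C>"
    and "\<And>L w. L \<in> \<C> \<Longrightarrow> L \<noteq> {} \<Longrightarrow> [] \<notin> L \<Longrightarrow> w \<in> L \<Longrightarrow> (L - {w}) \<union> {[]} \<in> \<C>"
    and "\<And>\<Sigma>\<^sub>1 \<Sigma>\<^sub>2 L\<^sub>1 L\<^sub>2 L\<^sub>1' L\<^sub>2'.
           finite \<Sigma>\<^sub>1 \<Longrightarrow> finite \<Sigma>\<^sub>2 \<Longrightarrow> L\<^sub>1 \<subseteq> lists \<Sigma>\<^sub>1 \<Longrightarrow> L\<^sub>2 \<subseteq> lists \<Sigma>\<^sub>2 \<Longrightarrow>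
           L\<^sub>1 \<in> \<C> \<Longrightarrow> L\<^sub>2 \<in> \<C> \<Longrightarrow> [] \<in> L\<^sub>1 \<Longrightarrow> [] \<in> L\<^sub>2 \<Longrightarrow> \<Sigma>\<^sub>1 \<inter> \<Sigma>\<^sub>2 = {} \<Longrightarrow>
           L\<^sub>1' = L\<^sub>1 - {[]} \<Longrightarrow> L\<^sub>2' = L\<^sub>2 - {[]} \<Longrightarrow>
           star (L\<^sub>1' \<cdot> L\<^sub>2') \<union> star (L\<^sub>1' \<cdot> L\<^sub>2') \<cdot> L\<^sub>1' \<union>
           star (L\<^sub>2' \<cdot> L\<^sub>1') \<union> star (L\<^sub>2' \<cdot> L\<^sub>1') \<cdot> L\<^sub>2' \<union> {[]} \<in> \<C>"
    and "cayley_pf_linear_time_computable \<C> G"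
    and "cayley_pf_linear_time_computable \<C> H"
  shows "cayley_pf_linear_time_computable \<C> (free_product G H)"
proof -
  obtain S \<Sigma> \<gamma> where S: "finite S" "semigroup_generators G S" and \<Sigma>: "finite \<Sigma>"
    and \<gamma>: "\<gamma> ` carrier G \<in> \<C>" "\<gamma> ` carrier G \<subseteq> lists \<Sigma>" "inj_on \<gamma> (carrier G)" "\<gamma> \<one>\<^bsub>G\<^esub> = []"
    and S_mult: "\<And>s. s \<in> S \<Longrightarrow>
      \<exists>f. pf_linear_time_computable \<Sigma> f \<and> (\<forall>g \<in> carrier G. f (\<gamma> g) = \<gamma> (g \<otimes>\<^bsub>G\<^esub> s))"
    by (rule cayley_normal_form[OF _ assms(4)])
      (rule assms(2), assumption+, rule that, assumption+)
  obtain T \<Delta> \<eta> where T: "finite T" "semigroup_generators H T" and \<Delta>: "finite \<Delta>"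
    and \<eta>: "\<eta> ` carrier H \<in> \<C>" "\<eta> ` carrier H \<subseteq> lists \<Delta>" "inj_on \<eta> (carrier H)" "\<eta> \<one>\<^bsub>H\<^esub> = []"
    and T_mult: "\<And>t. t \<in> T \<Longrightarrow>
      \<exists>f. pf_linear_time_computable \<Delta> f \<and> (\<forall>h \<in> carrier H. f (\<eta> h) = \<eta> (h \<otimes>\<^bsub>H\<^esub> t))"
    by (rule cayley_normal_form[OF _ assms(5)])
      (rule assms(2), assumption+, rule that, assumption+)
  \<comment> \<open>Even and odd numbers keep all symbols of the machines for the two factors apart.\<close>
  define \<xi> \<zeta> :: "nat \<Rightarrow> nat" where "\<xi> = (\<lambda>n. 2 * n)" and "\<zeta> = (\<lambda>n. 2 * n + 1)"
  have inj: "inj \<xi>" "inj \<zeta>" by (auto simp: inj_def \<xi>_def \<zeta>_def)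
  have even_odd: "range \<xi> \<inter> range \<zeta> = {}"
    unfolding \<xi>_def \<zeta>_def by (auto, presburger)
  define \<Sigma>' \<Delta>' where "\<Sigma>' = \<xi> ` \<Sigma>" and "\<Delta>' = \<zeta> ` \<Delta>"
  define \<gamma>' \<eta>' where "\<gamma>' = map \<xi> \<circ> \<gamma>" and "\<eta>' = map \<zeta> \<circ> \<eta>"
  have fin: "finite \<Sigma>'" "finite \<Delta>'" using \<Sigma> \<Delta> by (simp_all add: \<Sigma>'_def \<Delta>'_def)
  have disj: "\<Sigma>' \<inter> \<Delta>' = {}" "\<Delta>' \<inter> range \<xi> = {}" "\<Sigma>' \<inter> range \<zeta> = {}"
    using even_odd by (auto simp: \<Sigma>'_def \<Delta>'_def)
  have "group G" "group H"
    using assms(4,5) by (simp_all add: cayley_pf_linear_time_computable_def)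
  moreover have "\<gamma>' ` carrier G \<subseteq> lists \<Sigma>'" "\<eta>' ` carrier H \<subseteq> lists \<Delta>'"
    unfolding \<Sigma>'_def \<Delta>'_def \<gamma>'_def \<eta>'_def lists_image image_comp[symmetric]
    by (intro image_mono \<gamma>(2) \<eta>(2))+
  moreover have "inj_on \<gamma>' (carrier G)" "inj_on \<eta>' (carrier H)"
    unfolding \<gamma>'_def \<eta>'_def using \<gamma>(3) \<eta>(3) inj
    by (auto intro!: comp_inj_on inj_on_subset[OF inj_mapI])
  ultimately interpret factor_encodings G H \<Sigma>' \<Delta>' \<gamma>' \<eta>'
    using disj(1) \<gamma>(4) \<eta>(4)
    by (intro factor_encodings.intro free_factors.intro factor_encodings_axioms.intro)
      (simp_all add: \<gamma>'_def \<eta>'_def)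
  let ?U = "syllable G Inl ` S \<union> syllable H Inr ` T"
  define L where "L = encode ` carrier FP"
  have "\<gamma>' ` carrier G \<in> \<C>" "\<eta>' ` carrier H \<in> \<C>"
    using language_class_map[OF assms(1) \<Sigma> inj(1) \<gamma>(2,1)]
      language_class_map[OF assms(1) \<Delta> inj(2) \<eta>(2,1)]
    by (simp_all add: \<gamma>'_def \<eta>'_def image_comp)
  moreover have "[] \<in> \<gamma>' ` carrier G" "[] \<in> \<eta>' ` carrier H"
    using \<gamma>_one \<eta>_one by (metis G.one_closed H.one_closed imageI)+
  ultimately have L: "L \<in> \<C>"
    unfolding L_def encode_image[OF refl refl]
    by (intro assms(3)[OF fin \<gamma>_lists \<eta>_lists _ _ _ _ disj(1) refl refl])
  have L_lists: "L \<subseteq> lists (\<Sigma>' \<union> \<Delta>')"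
    using encode_in_lists by (auto simp: L_def)
  define \<psi> where "\<psi> = inv_into (carrier FP) encode"
  have \<psi>: "bij_betw \<psi> L (carrier FP)"
    unfolding \<psi>_def L_def by (intro bij_betw_inv_into bij_betw_imageI inj_on_encode refl)
  have \<psi>_encode: "\<psi> (encode w) = w" if "w \<in> carrier FP" for w
    unfolding \<psi>_def by (rule inv_into_f_f[OF inj_on_encode that])
  have mult: "\<exists>F. pf_linear_time_computable (\<Sigma>' \<union> \<Delta>') F \<and>
      (\<forall>w \<in> carrier FP. F (encode w) = encode (w \<otimes>\<^bsub>FP\<^esub> x))" if x: "x \<in> ?U" for x
    using x
  proof
    assume "x \<in> syllable G Inl ` S"
    then obtain s where s: "s \<in> S" "x = syllable G Inl s" by blast
    then have sG: "s \<in> carrier G" using S(2) unfolding semigroup_generators_def by blast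
    obtain f where f: "pf_linear_time_computable \<Sigma> f" "\<forall>g \<in> carrier G. f (\<gamma> g) = \<gamma> (g \<otimes>\<^bsub>G\<^esub> s)"
      using S_mult[OF s(1)] by blast
    obtain F where F: "pf_linear_time_computable (\<Sigma>' \<union> \<Delta>') F"
        "\<And>u g. u = [] \<or> last u \<in> \<Delta>' \<Longrightarrow> g \<in> carrier G \<Longrightarrow> F (u @ \<gamma>' g) = u @ \<gamma>' (g \<otimes>\<^bsub>G\<^esub> s)"
      using pf_linear_time_computable_right_mult[OF f(1) \<gamma>(2) f(2) fin(2) disj(2) inj(1)]
      unfolding \<Sigma>'_def \<gamma>'_def comp_def by blast
    have "F (encode w) = encode (w \<otimes>\<^bsub>FP\<^esub> x)" if "w \<in> carrier FP" for w
      using encode_mult_syllable_Inl[OF that] F(2) s(2) sG by metis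
    then show ?thesis using F(1) by blast
  next
    assume "x \<in> syllable H Inr ` T"
    then obtain t where t: "t \<in> T" "x = syllable H Inr t" by blast
    then have tH: "t \<in> carrier H" using T(2) unfolding semigroup_generators_def by blast
    obtain f where f: "pf_linear_time_computable \<Delta> f" "\<forall>h \<in> carrier H. f (\<eta> h) = \<eta> (h \<otimes>\<^bsub>H\<^esub> t)"
      using T_mult[OF t(1)] by blast
    obtain F where F: "pf_linear_time_computable (\<Delta>' \<union> \<Sigma>') F"
        "\<And>u h. u = [] \<or> last u \<in> \<Sigma>' \<Longrightarrow> h \<in> carrier H \<Longrightarrow> F (u @ \<eta>' h) = u @ \<eta>' (h \<otimes>\<^bsub>H\<^esub> t)"
      using pf_linear_time_computable_right_mult[OF f(1) \<eta>(2) f(2) fin(1) disj(3) inj(2)]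
      unfolding \<Delta>'_def \<eta>'_def comp_def by blast
    have "F (encode w) = encode (w \<otimes>\<^bsub>FP\<^esub> x)" if "w \<in> carrier FP" for w
      using encode_mult_syllable_Inr[OF that] F(2) t(2) tH by metis
    then show ?thesis using F(1) by (metis Un_commute)
  qed
  have gens: "semigroup_generators FP ?U"
    by (rule semigroup_generators_syllables[OF S(2) T(2)])
  have "\<forall>x \<in> ?U. \<exists>F. pf_linear_time_computable (\<Sigma>' \<union> \<Delta>') F \<and> F ` L \<subseteq> L \<and>
      (\<forall>w \<in> L. \<psi> (F w) = \<psi> w \<otimes>\<^bsub>FP\<^esub> x)"
  proof
    fix x assume x: "x \<in> ?U"
    then have x_in: "x \<in> carrier FP" using gens unfolding semigroup_generators_def by blast
    obtain F where F: "pf_linear_time_computable (\<Sigma>' \<union> \<Delta>') F"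
        "\<forall>w \<in> carrier FP. F (encode w) = encode (w \<otimes>\<^bsub>FP\<^esub> x)"
      using mult[OF x] by blast
    then have "F ` L \<subseteq> L" "\<forall>w \<in> L. \<psi> (F w) = \<psi> w \<otimes>\<^bsub>FP\<^esub> x"
      using x_in by (auto simp: L_def \<psi>_encode)
    then show "\<exists>F. pf_linear_time_computable (\<Sigma>' \<union> \<Delta>') F \<and> F ` L \<subseteq> L \<and>
      (\<forall>w \<in> L. \<psi> (F w) = \<psi> w \<otimes>\<^bsub>FP\<^esub> x)" using F(1) by blast
  qed
  moreover have "finite ?U" "finite (\<Sigma>' \<union> \<Delta>')" using S(1) T(1) fin by simp_all
  ultimately show ?thesis
    unfolding cayley_pf_linear_time_computable_def
    by (intro conjI exI[of _ ?U] exI[of _ "\<Sigma>' \<union> \<Delta>'"] exI[of _ L] exI[of _ \<psi>]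
        FP_group gens L L_lists \<psi>)
qed

end
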